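(* Consider the penalized scenario-based Value-at-Risk portfolio problem $\min_{\mathbf{w}\in\Delta}\ \phi(\mathbf{w}) := g(\mathbf{w}) - h(\mathbf{w})$ and the sequence $\{\mathbf{w}_k\}$ generated by the Boosted DC Algorithm (BDCA) with the line search, both as described in the context. Let $\bar{\mathbf{w}}\in\Delta$ be a limit point of $\{\mathbf{w}_k\}$. If $\nabla g$ or $\nabla h$ is locally Lipschitz continuous around $\bar{\mathbf{w}}$, then the sequence $\{\mathbf{w}_k\}$ converges linearly to $\bar{\mathbf{w}}$.
   Context: Data: $n,S\in\mathbb{N}$; scenario vectors $\mathbf{x}_1,\dots,\mathbf{x}_S\in\mathbb{R}^n$ with probabilities $p_1,\dots,p_S\in[0,1]$, $\sum_j p_j=1$. The feasible set is the simplex $\Delta=\{\mathbf{w}\in[0,1]^n:\sum_{i=1}^n w_i=1\}$. For $\mathbf{w}\in\mathbb{R}^n$ relabel the scenarios so that $\mathbf{w}^\top\mathbf{x}_1\le\cdots\le\mathbf{w}^\top\mathbf{x}_S$; for a level $a\in(0,1)$ let $k=\max\{k: \sum_{j=1}^k p_j< a\}$ (with $\max\emptyset=0$) and $\varepsilon=a-\sum_{j=1}^k p_j$, and define the discrete conditional value-at-risk $\mathrm{CVaR}_{X,a}(\mathbf{w})=\frac1a\sum_{j=1}^k p_j\,\mathbf{w}^\top\mathbf{x}_j+\frac{\varepsilon}{a}\,\mathbf{w}^\top\mathbf{x}_{k+1}$ (a concave piecewise linear function of $\mathbf{w}$). Fix $\alpha\in(0,1)$, with $k,\varepsilon$ the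 quantities above for level $\alpha$, a constant $\gamma$ with $0<\gamma<\varepsilon$, a threshold $r_{\min}\in\mathbb{R}$, a penalty parameter $\tau>0$, a regularization parameter $\rho>0$, and $\psi(\mathbf{w})=\frac{\rho}{2}\|\mathbf{w}\|^2$. Let $f(\mathbf{w})=-\sum_{j=1}^S p_j\,\mathbf{w}^\top\mathbf{x}_j$ and $g(\mathbf{w})=\psi(\mathbf{w})+f(\mathbf{w})+\tau\max\big[-\tfrac{\alpha}{\gamma}\mathrm{CVaR}_{X,\alpha}(\mathbf{w})+r_{\min},\ -\tfrac{\alpha-\gamma}{\gamma}\mathrm{CVaR}_{X,\alpha-\gamma}(\mathbf{w})\big]$, $h(\mathbf{w})=\psi(\mathbf{w})-\tau\,\tfrac{\alpha-\gamma}{\gamma}\mathrm{CVaR}_{X,\alpha-\gamma}(\mathbf{w})$, and $\phi=g-h$. BDCA: input $\mathbf{w}_0\in\Delta$, $\tau,\rho>0$, $\beta\in(0,1)$. For $k=0,1,2,\dots$: choose $\mathbf{u}_k\in\partial h(\mathbf{w}_k)$ (convex subdifferential); let $\mathbf{y}_k=\arg\min_{\mathbf{w}\in\Delta}\{g(\mathbf{w})-\mathbf{w}^\top\mathbf{u}_k\}$; $\mathbf{d}_k=\mathbf{y}_k-\mathbf{w}_k$; if $\|\mathbf{d}_k\|=0$ stop; otherwise set $\lambda_k=\max\{\lambda: \mathbf{w}_k+\lambda\mathbf{d}_k\in\Delta\}$ and, while $\phi(\mathbf{w}_k+\lambda_k\mathbf{d}_k)>\phi(\mathbf{w}_k)-\rho\lambda_k^2\|\mathbf{d}_k\|^2$,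 replace $\lambda_k$ by $\max\{1,\beta\lambda_k\}$; then set $\mathbf{w}_{k+1}=\mathbf{w}_k+\lambda_k\mathbf{d}_k$. *)

theory Defs
  imports "HOL-Analysis.Analysis"
begin

text \<open>Scenarios are indexed by 0..<S: x j is the j-th scenario vector, p j its probability.\<close>

definition pf_simplex :: "(real ^ 'n) set" where
  "pf_simplex = {w. (\<forall>i. 0 \<le> w $ i \<and> w $ i \<le> 1) \<and> (\<Sum>i\<in>UNIV. w $ i) = 1}"

definition sort_perm :: "nat \<Rightarrow> (nat \<Rightarrow> real ^ 'n) \<Rightarrow> real ^ 'n \<Rightarrow> nat \<Rightarrow> nat" where
  "sort_perm S x w = (SOME \<sigma>. \<sigma> permutes {..<S} \<and>
      (\<forall>i j. i \<le> j \<and> j < S \<longrightarrow> w \<bullet> x (\<sigma> i) \<le> w \<bullet> x (\<sigma> j)))"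

definition cvar_k :: "nat \<Rightarrow> (nat \<Rightarrow> real ^ 'n) \<Rightarrow> (nat \<Rightarrow> real) \<Rightarrow> real \<Rightarrow> real ^ 'n \<Rightarrow> nat" where
  "cvar_k S x p a w = (let \<sigma> = sort_perm S x w in
      Max {k. k \<le> S \<and> (\<Sum>j<k. p (\<sigma> j)) < a})"

definition cvar_eps :: "nat \<Rightarrow> (nat \<Rightarrow> real ^ 'n) \<Rightarrow> (nat \<Rightarrow> real) \<Rightarrow> real \<Rightarrow> real ^ 'n \<Rightarrow> real" where
  "cvar_eps S x p a w = (let \<sigma> = sort_perm S x w in
      a - (\<Sum>j<cvar_k S x p a w. p (\<sigma> j)))"

definition cvar :: "nat \<Rightarrow> (nat \<Rightarrow> real ^ 'n) \<Rightarrow> (nat \<Rightarrow> real) \<Rightarrow> real \<Rightarrow> real ^ 'n \<Rightarrow> real" where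
  "cvar S x p a w = (let \<sigma> = sort_perm S x w; k = cvar_k S x p a w in
      (1 / a) * (\<Sum>j<k. p (\<sigma> j) * (w \<bullet> x (\<sigma> j)))
      + (cvar_eps S x p a w / a) * (w \<bullet> x (\<sigma> k)))"

definition fobj :: "nat \<Rightarrow> (nat \<Rightarrow> real ^ 'n) \<Rightarrow> (nat \<Rightarrow> real) \<Rightarrow> real ^ 'n \<Rightarrow> real" where
  "fobj S x p w = - (\<Sum>j<S. p j * (w \<bullet> x j))"

definition psi :: "real \<Rightarrow> real ^ 'n \<Rightarrow> real" where
  "psi \<rho> w = \<rho> / 2 * (norm w)\<^sup>2"

definition gfun :: "nat \<Rightarrow> (nat \<Rightarrow> real ^ 'n) \<Rightarrow> (nat \<Rightarrow> real) \<Rightarrow> real \<Rightarrow> real \<Rightarrow> real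
    \<Rightarrow> real \<Rightarrow> real \<Rightarrow> real ^ 'n \<Rightarrow> real" where
  "gfun S x p \<alpha> \<gamma> rmin \<tau> \<rho> w = psi \<rho> w + fobj S x p w
     + \<tau> * max (- (\<alpha> / \<gamma>) * cvar S x p \<alpha> w + rmin)
                (- ((\<alpha> - \<gamma>) / \<gamma>) * cvar S x p (\<alpha> - \<gamma>) w)"

definition hfun :: "nat \<Rightarrow> (nat \<Rightarrow> real ^ 'n) \<Rightarrow> (nat \<Rightarrow> real) \<Rightarrow> real \<Rightarrow> real
    \<Rightarrow> real \<Rightarrow> real \<Rightarrow> real ^ 'n \<Rightarrow> real" where
  "hfun S x p \<alpha> \<gamma> \<tau> \<rho> w = psi \<rho> w - \<tau> * ((\<alpha> - \<gamma>) / \<gamma>) * cvar S x p (\<alpha> - \<gamma>) w"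

definition phifun :: "nat \<Rightarrow> (nat \<Rightarrow> real ^ 'n) \<Rightarrow> (nat \<Rightarrow> real) \<Rightarrow> real \<Rightarrow> real \<Rightarrow> real
    \<Rightarrow> real \<Rightarrow> real \<Rightarrow> real ^ 'n \<Rightarrow> real" where
  "phifun S x p \<alpha> \<gamma> rmin \<tau> \<rho> w = gfun S x p \<alpha> \<gamma> rmin \<tau> \<rho> w - hfun S x p \<alpha> \<gamma> \<tau> \<rho> w"

definition convex_subdiff :: "(real ^ 'n \<Rightarrow> real) \<Rightarrow> real ^ 'n \<Rightarrow> (real ^ 'n) set" where
  "convex_subdiff F w = {u. \<forall>z. F z \<ge> F w + u \<bullet> (z - w)}"

definition max_step :: "real ^ 'n \<Rightarrow> real ^ 'n \<Rightarrow> real" where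
  "max_step w d = Sup {l. w + l *\<^sub>R d \<in> pf_simplex}"

definition bdca_stepsize :: "(real ^ 'n \<Rightarrow> real) \<Rightarrow> real \<Rightarrow> real \<Rightarrow> real ^ 'n \<Rightarrow> real ^ 'n \<Rightarrow> real" where
  "bdca_stepsize \<phi> \<rho> \<beta> w d =
     (let trial = (\<lambda>j. ((\<lambda>l. max 1 (\<beta> * l)) ^^ j) (max_step w d));
          J = (LEAST j. \<not> (\<phi> (w + trial j *\<^sub>R d) > \<phi> w - \<rho> * (trial j)\<^sup>2 * (norm d)\<^sup>2))
      in trial J)"

definition grad_locally_lipschitz_at :: "(real ^ 'n \<Rightarrow> real) \<Rightarrow> real ^ 'n \<Rightarrow> bool" where
  "grad_locally_lipschitz_at F z = (\<exists>\<delta>>0. \<exists>G L.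
      (\<forall>v\<in>ball z \<delta>. (F has_derivative (\<lambda>t. G v \<bullet> t)) (at v)) \<and>
      (\<forall>a\<in>ball z \<delta>. \<forall>b\<in>ball z \<delta>. norm (G a - G b) \<le> L * norm (a - b)))"

end

theory Submission
  imports Defs
begin

text \<open>
  Write \<open>g = \<psi> + G\<close> and \<open>h = \<psi> + H\<close>; both \<open>G\<close> and \<open>H\<close> are maxima of finitely many affine
  functions, so \<open>\<phi> = G - H\<close> is piecewise linear. The values \<open>\<phi> w\<^sub>k\<close> decrease to
  \<open>\<phi> wbar\<close>, and a polyhedral error bound gives \<open>\<phi> y\<^sub>k \<le> \<phi> wbar\<close> as soon as \<open>w\<^sub>k\<close> is
  close to \<open>wbar\<close> and the step is short.

  If \<open>g\<close> is smooth at \<open>wbar\<close>, then \<open>G\<close> is affine and \<open>\<phi>\<close> concave near \<open>wbar\<close>. As \<open>y\<^sub>k\<close> lies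
  between \<open>w\<^sub>k\<close> and the next iterate, concavity forces the latter to have value \<open>\<phi> wbar\<close>, and the
  iteration stops.

  If \<open>h\<close> is smooth at \<open>wbar\<close>, then \<open>H\<close> is affine near \<open>wbar\<close>, and so is the value-at-risk, because the
  scenario that carries the fractional weight of the tail cannot tie with a different one.
  Hence \<open>\<phi>\<close> is locally a maximum of two affine functions, and \<open>y\<^sub>k\<close> is the projection of
  \<open>w\<^sub>k\<close> onto the minimisers of \<open>\<phi>\<close>. If the iteration does not stop, every step overshoots
  \<open>y\<^sub>k\<close>. Then the direction \<open>y\<^sub>k - w\<^sub>k\<close> is determined by the support of \<open>y\<^sub>k\<close> up to a factor, and the slope of
  \<open>\<phi>\<close> along it, measured by one of the two pieces, never decreases. It takes finitely many values, so it is
  eventually constant, and from then on all iterates lie on one line on alternating sides of a fixed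
  \<open>y\<^sub>k\<close>. On such a line the trial steps are the distance to the boundary times powers of
  \<open>\<beta>\<close>, and strict descent forces a larger power whenever the same side is visited again: the step length
  shrinks by the factor \<open>\<beta>\<close> every two steps.
\<close>

section \<open>Maxima of finitely many affine functions\<close>

definition affine_max :: "('a::euclidean_space \<times> real) set \<Rightarrow> 'a \<Rightarrow> real" where
  "affine_max A v = Max ((\<lambda>q. fst q \<bullet> v + snd q) ` A)"

definition active :: "('a::euclidean_space \<times> real) set \<Rightarrow> 'a \<Rightarrow> ('a \<times> real) set" where
  "active A v = {q \<in> A. fst q \<bullet> v + snd q = affine_max A v}"

lemma affine_max_ge: "finite A \<Longrightarrow> q \<in> A \<Longrightarrow> fst q \<bullet> v + snd q \<le> affine_max A v"
  unfolding affine_max_def by (rule Max_ge) auto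

lemma active_nonempty:
  assumes "finite A" "A \<noteq> {}"
  shows "active A v \<noteq> {}"
proof -
  have "affine_max A v \<in> (\<lambda>q. fst q \<bullet> v + snd q) ` A"
    unfolding affine_max_def using assms by (intro Max_in) auto
  then obtain q where "q \<in> A" "affine_max A v = fst q \<bullet> v + snd q" by blast
  then show ?thesis unfolding active_def by force
qed

lemma affine_max_le:
  assumes "finite A" "A \<noteq> {}" "\<And>q. q \<in> A \<Longrightarrow> fst q \<bullet> v + snd q \<le> b"
  shows "affine_max A v \<le> b"
  unfolding affine_max_def using assms by (intro Max.boundedI) auto

lemma affine_max_eqI:
  assumes "finite A" "\<And>q. q \<in> A \<Longrightarrow> fst q \<bullet> v + snd q \<le> b" "q0 \<in> A" "fst q0 \<bullet> v + snd q0 = b"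
  shows "affine_max A v = b"
  using affine_max_le[OF assms(1) _ assms(2)] affine_max_ge[OF assms(1,3), of v] assms(3,4) by fastforce

lemma convex_on_affine_max:
  assumes A: "finite A" "A \<noteq> {}"
  shows "convex_on UNIV (affine_max A)"
proof (rule convex_onI)
  fix t :: real and a b :: 'a
  assume t: "0 < t" "t < 1"
  show "affine_max A ((1 - t) *\<^sub>R a + t *\<^sub>R b) \<le> (1 - t) * affine_max A a + t * affine_max A b"
  proof (rule affine_max_le[OF A])
    fix q assume q: "q \<in> A"
    have "fst q \<bullet> ((1 - t) *\<^sub>R a + t *\<^sub>R b) + snd q
        = (1 - t) * (fst q \<bullet> a + snd q) + t * (fst q \<bullet> b + snd q)"
      by (simp add: inner_add_right algebra_simps)
    also have "\<dots> \<le> (1 - t) * affine_max A a + t * affine_max A b"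
      using t affine_max_ge[OF A(1) q] by (intro add_mono mult_left_mono) auto
    finally show "fst q \<bullet> ((1 - t) *\<^sub>R a + t *\<^sub>R b) + snd q
        \<le> (1 - t) * affine_max A a + t * affine_max A b" .
  qed
qed auto

lemma isCont_affine_max:
  assumes "finite A" "A \<noteq> {}"
  shows "isCont (affine_max A) v"
  using convex_on_continuous[OF open_UNIV convex_on_affine_max[OF assms]]
  by (simp add: continuous_on_eq_continuous_at)

text \<open>A piece that is inactive at \<open>z\<close> lies strictly below the maximum there, and
  finitely many strict inequalities between continuous functions persist in a neighbourhood.\<close>

lemma active_subset_nearby:
  fixes z :: "'a::euclidean_space"
  assumes A: "finite A" "A \<noteq> {}"
  shows "\<exists>\<delta>>0. \<forall>v\<in>ball z \<delta>. active A v \<subseteq> active A z"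
proof -
  have "\<forall>\<^sub>F v in nhds z. q \<notin> active A v" if q: "q \<in> A - active A z" for q
  proof -
    have lt: "fst q \<bullet> z + snd q < affine_max A z"
      using q affine_max_ge[OF A(1), of q z] unfolding active_def by fastforce
    have "((\<lambda>v. affine_max A v - (fst q \<bullet> v + snd q)) \<longlongrightarrow> affine_max A z - (fst q \<bullet> z + snd q)) (nhds z)"
      using isCont_affine_max[OF A, of z] unfolding isCont_def tendsto_at_iff_tendsto_nhds
      by (intro tendsto_intros filterlim_ident)
    from order_tendstoD(1)[OF this, of 0] lt show ?thesis
      by (auto simp: active_def elim!: eventually_mono)
  qed
  then have "\<forall>\<^sub>F v in nhds z. \<forall>q \<in> A - active A z. q \<notin> active A v"
    using A(1) by (subst eventually_ball_finite_distrib) auto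
  then obtain \<delta> where "\<delta> > 0" and \<delta>: "\<And>v. dist v z < \<delta> \<Longrightarrow> \<forall>q \<in> A - active A z. q \<notin> active A v"
    unfolding eventually_nhds_metric by blast
  moreover have "active A v \<subseteq> active A z" if "v \<in> ball z \<delta>" for v
    using \<delta>[of v] that unfolding active_def by (auto simp: dist_commute)
  ultimately show ?thesis by blast
qed

text \<open>A piece that is active slightly further along \<open>\<zeta>\<close> was already active
  at \<open>v\<close>, so the common slope \<open>m\<close> decides the value there.\<close>

lemma affine_max_along:
  assumes A: "finite A" "A \<noteq> {}"
    and slope: "\<And>q. q \<in> active A v \<Longrightarrow> fst q \<bullet> \<zeta> = m"
  shows "\<exists>t0>0. \<forall>t. 0 \<le> t \<and> t \<le> t0 \<longrightarrow> affine_max A (v + t *\<^sub>R \<zeta>) = affine_max A v + t * m"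
proof -
  obtain \<delta> where \<delta>: "\<delta> > 0" "\<And>v'. v' \<in> ball v \<delta> \<Longrightarrow> active A v' \<subseteq> active A v"
    using active_subset_nearby[OF A, of v] by blast
  define t0 where "t0 = \<delta> / (2 * (norm \<zeta> + 1))"
  have pos: "norm \<zeta> + 1 > 0" using norm_ge_zero[of \<zeta>] by linarith
  have "affine_max A (v + t *\<^sub>R \<zeta>) = affine_max A v + t * m" if t: "0 \<le> t" "t \<le> t0" for t
  proof -
    have "t * norm \<zeta> \<le> t0 * norm \<zeta>" using t by (intro mult_right_mono) auto
    also have "\<dots> < \<delta>"
      using \<delta>(1) pos unfolding t0_def by (simp add: divide_less_eq mult.commute add_pos_nonneg)
    finally have "v + t *\<^sub>R \<zeta> \<in> ball v \<delta>" using t by (simp add: dist_norm)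
    with \<delta>(2) obtain q where q: "q \<in> active A (v + t *\<^sub>R \<zeta>)" "q \<in> active A v"
      using active_nonempty[OF A] by blast
    then show ?thesis
      using slope[OF q(2)] unfolding active_def by (simp add: inner_add_right)
  qed
  moreover have "t0 > 0" using \<delta>(1) pos unfolding t0_def by simp
  ultimately show ?thesis by blast
qed

text \<open>All pieces active at \<open>v\<close> have the same slope along \<open>v - z\<close>, so
  the maximum stays affine slightly beyond \<open>v\<close>. Testing the inequality there bounds
  \<open>e \<bullet> (v - z)\<close> by the difference of the two values, which moves the base point
  from \<open>v\<close> to \<open>z\<close>.\<close>

lemma subgradient_affine_max_limit:
  assumes A: "finite A" "A \<noteq> {}"
    and act: "active A v \<subseteq> active A z"
    and e: "\<And>v'. affine_max A v + e \<bullet> (v' - v) \<le> affine_max A v'"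
  shows "affine_max A z + e \<bullet> (v' - z) \<le> affine_max A v'"
proof -
  have "fst q \<bullet> (v - z) = affine_max A v - affine_max A z" if "q \<in> active A v" for q
    using that act by (force simp: active_def inner_diff_right)
  from affine_max_along[OF A this] obtain t where t: "t > 0"
    "\<forall>s. 0 \<le> s \<and> s \<le> t \<longrightarrow> affine_max A (v + s *\<^sub>R (v - z)) = affine_max A v + s * (affine_max A v - affine_max A z)"
    by blast
  then have "affine_max A (v + t *\<^sub>R (v - z)) = affine_max A v + t * (affine_max A v - affine_max A z)"
    by simp
  with t(1) e[of "v + t *\<^sub>R (v - z)"] have "e \<bullet> (v - z) \<le> affine_max A v - affine_max A z"
    by simp
  with e[of v'] show ?thesis by (simp add: inner_diff_right)
qed

lemma supporting_functional_eq_gradient: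
  fixes F :: "'a::euclidean_space \<Rightarrow> real"
  assumes D: "(F has_derivative (\<lambda>t. D \<bullet> t)) (at z)"
    and supp: "\<And>v. F z + e \<bullet> (v - z) \<le> F v"
  shows "e = D"
proof -
  have "((\<lambda>v. F v - e \<bullet> v) has_derivative (\<lambda>t. D \<bullet> t - e \<bullet> t)) (at z)"
    by (intro derivative_intros D)
  moreover have "\<forall>v\<in>ball z 1. F z - e \<bullet> z \<le> F v - e \<bullet> v"
  proof
    fix v show "F z - e \<bullet> z \<le> F v - e \<bullet> v"
      using supp[of v] by (simp add: inner_diff_right)
  qed
  ultimately have "(\<lambda>t. D \<bullet> t - e \<bullet> t) = (\<lambda>t. 0)"
    by (intro has_derivative_local_min[where f = "\<lambda>v. F v - e \<bullet> v" and x = z])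
      (auto simp: eventually_at intro!: exI[of _ 1] simp: dist_commute)
  then have "D \<bullet> (D - e) - e \<bullet> (D - e) = 0" by metis
  then have "(D - e) \<bullet> (D - e) = 0" by (simp add: inner_diff_left)
  then show ?thesis by simp
qed

text \<open>Every active piece supports the maximum at \<open>z\<close>, so differentiability forces
  each of them to have gradient \<open>D\<close>; nearby no other piece becomes active.\<close>

lemma differentiable_affine_max_locally_affine:
  assumes A: "finite A" "A \<noteq> {}"
    and D: "(affine_max A has_derivative (\<lambda>t. D \<bullet> t)) (at z)"
  shows "\<exists>\<delta>>0. \<forall>v\<in>ball z \<delta>. affine_max A v = affine_max A z + D \<bullet> (v - z)"
proof -
  obtain \<delta> where \<delta>: "\<delta> > 0" "\<And>v. v \<in> ball z \<delta> \<Longrightarrow> active A v \<subseteq> active A z"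
    using active_subset_nearby[OF A, of z] by blast
  have "affine_max A v = affine_max A z + D \<bullet> (v - z)" if v: "v \<in> ball z \<delta>" for v
  proof -
    obtain q where q: "q \<in> active A v" "q \<in> active A z"
      using \<delta>(2)[OF v] active_nonempty[OF A] by blast
    have "affine_max A z + fst q \<bullet> (v' - z) \<le> affine_max A v'" for v'
      using q(2) affine_max_ge[OF A(1), of q v'] by (auto simp: active_def inner_diff_right)
    from supporting_functional_eq_gradient[OF D this] have "fst q = D" .
    with q show ?thesis by (auto simp: active_def inner_diff_right)
  qed
  with \<delta>(1) show ?thesis by blast
qed

text \<open>Serves to assemble the pieces of both DC components from those of the two tail
  functionals.\<close>

lemma affine_max_scale_add:
  assumes A: "finite A" "A \<noteq> {}" and k: "0 \<le> k"
  shows "affine_max ((\<lambda>q. (b + k *\<^sub>R fst q, c + k * snd q)) ` A) v = b \<bullet> v + c + k * affine_max A v"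
proof -
  obtain q where "q \<in> active A v" using active_nonempty[OF A] by blast
  then have q: "q \<in> A" "fst q \<bullet> v + snd q = affine_max A v" by (auto simp: active_def)
  show ?thesis
  proof (rule affine_max_eqI[of _ _ _ "(b + k *\<^sub>R fst q, c + k * snd q)"])
    fix r assume "r \<in> (\<lambda>q. (b + k *\<^sub>R fst q, c + k * snd q)) ` A"
    then obtain q where q: "q \<in> A" "r = (b + k *\<^sub>R fst q, c + k * snd q)" by blast
    have "k * (fst q \<bullet> v + snd q) \<le> k * affine_max A v"
      using affine_max_ge[OF A(1) q(1)] k by (intro mult_left_mono)
    then show "fst r \<bullet> v + snd r \<le> b \<bullet> v + c + k * affine_max A v"
      using q(2) by (simp add: inner_add_left algebra_simps)
  qed (use A q in \<open>auto simp: q(2)[symmetric] inner_add_left algebra_simps\<close>)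
qed

lemma affine_max_Un:
  assumes "finite A" "A \<noteq> {}" "finite B" "B \<noteq> {}"
  shows "affine_max (A \<union> B) v = max (affine_max A v) (affine_max B v)"
  unfolding affine_max_def image_Un using assms by (intro Max_Un) auto

section \<open>Feasible directions of the simplex\<close>

lemma pf_simplex_iff: "v \<in> pf_simplex \<longleftrightarrow> (\<forall>i. 0 \<le> v $ i) \<and> (\<Sum>i\<in>UNIV. v $ i) = 1"
proof -
  have "v $ i \<le> 1" if "\<forall>i. 0 \<le> v $ i" "(\<Sum>i\<in>UNIV. v $ i) = 1" for i
    using member_le_sum[of i UNIV "\<lambda>i. v $ i"] that by auto
  then show ?thesis unfolding pf_simplex_def by auto
qed

lemma pf_simplex_add_scaleR:
  fixes v \<zeta> :: "real ^ 'n"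
  assumes "v \<in> pf_simplex" "(\<Sum>i\<in>UNIV. \<zeta> $ i) = 0" "\<And>i. 0 \<le> v $ i + t * \<zeta> $ i"
  shows "v + t *\<^sub>R \<zeta> \<in> pf_simplex"
  using assms by (simp add: pf_simplex_iff sum.distrib flip: sum_distrib_left)

lemma sum_diff_pf_simplex:
  assumes "a \<in> pf_simplex" "b \<in> pf_simplex"
  shows "(\<Sum>i\<in>UNIV. (a - b) $ i) = 0"
  using assms by (simp add: pf_simplex_iff sum_subtractf)

text \<open>A short step endangers only the coordinates that vanish at \<open>v\<close>; a positive
  coordinate stays positive.\<close>

lemma pf_simplex_feasible_direction:
  fixes v \<zeta> :: "real ^ 'n"
  assumes v: "v \<in> pf_simplex" and sum: "(\<Sum>i\<in>UNIV. \<zeta> $ i) = 0"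
    and nonneg: "\<And>i. v $ i = 0 \<Longrightarrow> 0 \<le> \<zeta> $ i"
  shows "\<exists>t0>0. \<forall>t. 0 \<le> t \<and> t \<le> t0 \<longrightarrow> v + t *\<^sub>R \<zeta> \<in> pf_simplex"
proof -
  have "\<forall>\<^sub>F t in at_right 0. 0 \<le> v $ i + t * \<zeta> $ i" for i
  proof (cases "v $ i = 0")
    case True
    then show ?thesis using nonneg[OF True] eventually_at_right_less[of "0::real"]
      by (auto elim!: eventually_mono)
  next
    case False
    with v have "0 < v $ i" by (simp add: pf_simplex_iff order_less_le)
    moreover have "((\<lambda>t. v $ i + t * \<zeta> $ i) \<longlongrightarrow> v $ i + 0 * \<zeta> $ i) (at_right 0)"
      by (intro tendsto_intros)
    ultimately show ?thesis
      using order_tendstoD(1)[of "\<lambda>t. v $ i + t * \<zeta> $ i" "v $ i" "at_right 0" 0]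
      by (auto elim!: eventually_mono)
  qed
  then have "\<forall>\<^sub>F t in at_right 0. \<forall>i. 0 \<le> v $ i + t * \<zeta> $ i"
    by (simp add: eventually_all_finite)
  then obtain b where b: "b > 0" "\<forall>t>0. t < b \<longrightarrow> (\<forall>i. 0 \<le> v $ i + t * \<zeta> $ i)"
    unfolding eventually_at_right_field by blast
  have "v + t *\<^sub>R \<zeta> \<in> pf_simplex" if "0 \<le> t" "t \<le> b / 2" for t
  proof (cases "t = 0")
    case True then show ?thesis using v by simp
  next
    case False
    then show ?thesis using that b by (intro pf_simplex_add_scaleR v sum) auto
  qed
  with b(1) show ?thesis by (intro exI[of _ "b/2"]) auto
qed

lemma convex_pf_simplex: "convex (pf_simplex :: (real ^ 'n) set)"
proof (rule convexI)
  fix a b :: "real ^ 'n" and s t :: real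
  assume "a \<in> pf_simplex" "b \<in> pf_simplex" "0 \<le> s" "0 \<le> t" "s + t = 1"
  then show "s *\<^sub>R a + t *\<^sub>R b \<in> pf_simplex"
    by (auto simp: pf_simplex_iff sum.distrib simp flip: sum_distrib_left)
qed

lemma compact_pf_simplex: "compact (pf_simplex :: (real ^ 'n) set)"
proof -
  have "pf_simplex = (\<Inter>i. {v::real^'n. 0 \<le> v $ i}) \<inter> {v. (\<Sum>i\<in>UNIV. v $ i) = 1}"
    by (auto simp: pf_simplex_iff)
  moreover have "closed ((\<Inter>i. {v::real^'n. 0 \<le> v $ i}) \<inter> {v. (\<Sum>i\<in>UNIV. v $ i) = 1})"
    by (intro closed_Int closed_INT ballI closed_Collect_le closed_Collect_eq continuous_intros)
  moreover have "bounded (pf_simplex :: (real ^ 'n) set)"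
  proof (rule boundedI)
    fix v :: "real ^ 'n" assume "v \<in> pf_simplex"
    then have "(\<Sum>i\<in>UNIV. \<bar>v $ i\<bar>) = 1" by (simp add: pf_simplex_iff)
    then show "norm v \<le> 1" using norm_le_l1_cart[of v] by simp
  qed
  ultimately show ?thesis by (simp add: compact_eq_bounded_closed)
qed

section \<open>Scalar inequalities\<close>

text \<open>The parameter runs along a step: -1 is \<open>w k\<close>, 0 is \<open>y k\<close>, and
  \<open>l\<close> is the next iterate. If one piece were negative at 0, the other alone would be
  the maximum near 0, hence constantly zero; the first would then be positive at both ends and
  negative in between, which no affine function is.\<close>

lemma two_piece_kink:
  fixes s1 s2 a1 a2 l :: real
  assumes zero: "max s1 s2 = 0" and l: "0 < l"
    and nonneg: "\<And>t. - 1 \<le> t \<Longrightarrow> t \<le> l \<Longrightarrow> 0 \<le> max (s1 + t * a1) (s2 + t * a2)"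
    and left: "0 < max (s1 - a1) (s2 - a2)" and right: "0 < max (s1 + l * a1) (s2 + l * a2)"
  shows "s1 = 0 \<and> s2 = 0 \<and> (a1 < 0 \<and> 0 < a2 \<or> 0 < a1 \<and> a2 < 0)"
proof -
  have key: False
    if h: "s2 < 0" "s1 = 0" and nonneg: "\<And>t. - 1 \<le> t \<Longrightarrow> t \<le> l \<Longrightarrow> 0 \<le> max (s1 + t * a1) (s2 + t * a2)"
      and left: "0 < max (s1 - a1) (s2 - a2)" and right: "0 < max (s1 + l * a1) (s2 + l * a2)"
    for s1 s2 a1 a2 :: real
  proof -
    \<comment> \<open>Small enough that the second piece stays negative on the interval from
      \<open>- r\<close> to \<open>r\<close>.\<close>
    define r where "r = min (min 1 l) (- s2 / (2 * (\<bar>a2\<bar> + 1)))"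
    have pos: "0 < \<bar>a2\<bar> + 1" by simp
    have r: "0 < r" "r \<le> 1" "r \<le> l" using h l pos unfolding r_def by (auto simp: divide_less_0_iff)
    have "r * (\<bar>a2\<bar> + 1) \<le> (- s2 / (2 * (\<bar>a2\<bar> + 1))) * (\<bar>a2\<bar> + 1)"
      unfolding r_def using pos by (intro mult_right_mono) auto
    also have "\<dots> = - s2 / 2" using pos by (simp add: field_simps)
    finally have "r * \<bar>a2\<bar> < - s2" using r h by (simp add: algebra_simps)
    then have "\<bar>r * a2\<bar> < - s2" using r by (simp add: abs_mult)
    then have small: "s2 + r * a2 < 0" "s2 + (- r) * a2 < 0" by auto
    have "0 \<le> r * a1" "0 \<le> - r * a1"
      using nonneg[of r] nonneg[of "- r"] small r h by (auto simp: max_def split: if_splits)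
    then have "r * a1 = 0" by linarith
    then have "a1 = 0" using r by simp
    then have "a2 < s2" "0 < s2 + l * a2" using left right h by (auto simp: max_def split: if_splits)
    moreover have "l * a2 \<le> 0" using calculation(1) h l by (simp add: mult_le_0_iff)
    ultimately show False using h by linarith
  qed
  have "\<not> (s2 < 0 \<and> s1 = 0)" using key[OF _ _ nonneg left right] by blast
  moreover have "\<not> (s1 < 0 \<and> s2 = 0)"
  proof
    assume "s1 < 0 \<and> s2 = 0"
    moreover have "0 \<le> max (s2 + t * a2) (s1 + t * a1)" if "- 1 \<le> t" "t \<le> l" for t
      using nonneg[OF that] by (simp add: max.commute)
    ultimately show False
      using key[of s1 s2 a2 a1] left right by (metis max.commute)
  qed
  ultimately have s: "s1 = 0" "s2 = 0" using zero by (auto simp: max_def split: if_splits)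
  moreover have "a1 < 0 \<or> a2 < 0" "0 < a1 \<or> 0 < a2"
    using left right s l by (auto simp: max_def zero_less_mult_iff split: if_splits)
  ultimately show ?thesis by auto
qed

text \<open>Two visits of the same side of a fixed point are compared, with directions of length
  ratio \<open>\<mu>\<close>. By \<open>rel\<close> both full steps end at the same boundary point;
  by \<open>less\<close> the second overshoot is strictly smaller. Without an additional reduction
  the overshoot could not shrink, so \<open>j < j'\<close>, which yields the factor
  \<open>\<beta>\<close>.\<close>

lemma backtracking_contraction:
  fixes \<beta> \<mu> \<Lambda> \<Lambda>' :: real
  assumes \<beta>: "0 < \<beta>" "\<beta> < 1" and \<mu>: "0 < \<mu>" "\<mu> \<le> 1" and \<Lambda>: "1 \<le> \<Lambda>"
    and rel: "\<Lambda>' * \<mu> = \<Lambda> + \<mu> - 1"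
    and less: "(\<Lambda>' * \<beta> ^ j' - 1) * \<mu> < \<Lambda> * \<beta> ^ j - 1"
  shows "\<Lambda>' * \<beta> ^ j' * \<mu> \<le> \<beta> * (\<Lambda> * \<beta> ^ j)"
proof -
  have j: "j < j'"
  proof (rule ccontr)
    assume "\<not> j < j'"
    then have "\<beta> ^ j \<le> \<beta> ^ j'" using \<beta> by (intro power_decreasing) auto
    then have "(\<Lambda> + \<mu> - 1) * \<beta> ^ j \<le> (\<Lambda> + \<mu> - 1) * \<beta> ^ j'"
      using \<mu> \<Lambda> by (intro mult_left_mono) auto
    moreover have "0 \<le> (1 - \<beta> ^ j) * (1 - \<mu>)"
      using \<beta> \<mu> by (intro mult_nonneg_nonneg) (auto simp: power_le_one)
    moreover have "(\<Lambda>' * \<beta> ^ j' - 1) * \<mu> = (\<Lambda> + \<mu> - 1) * \<beta> ^ j' - \<mu>"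
      unfolding rel[symmetric] by (simp add: algebra_simps)
    ultimately show False using less by (simp add: algebra_simps)
  qed
  have "\<Lambda>' * \<beta> ^ j' * \<mu> = (\<Lambda> + \<mu> - 1) * \<beta> ^ j'" unfolding rel[symmetric] by simp
  also have "\<dots> \<le> \<Lambda> * \<beta> ^ Suc j"
    using \<mu> \<Lambda> \<beta> j by (intro mult_mono power_decreasing) auto
  finally show ?thesis by (simp add: mult_ac)
qed

text \<open>The contraction may fail whenever \<open>r\<close> jumps, but the jumps telescope along
  the even and along the odd indices, so together they cost at most
  \<open>2 * N * \<eta>\<close>.\<close>

lemma geometric_sum_bound_with_jumps:
  fixes D :: "nat \<Rightarrow> real" and r :: "nat \<Rightarrow> nat"
  assumes \<beta>: "0 < \<beta>" "\<beta> < 1" and D: "\<And>i. 0 \<le> D i" "\<And>i. D i \<le> \<eta>"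
    and r: "\<And>i. r i \<le> N" and m: "1 \<le> m"
    and rec: "\<And>i. i + 2 \<le> m \<Longrightarrow> D (i + 2) \<le> \<beta> * D i + \<eta> * (real (r (i + 2)) - real (r i))"
  shows "(1 - \<beta>) * (\<Sum>i\<le>m. D i) \<le> (2 + 2 * real N) * \<eta>"
proof -
  \<comment> \<open>The terms with \<open>m\<close> and \<open>m - 1\<close> are what the two
    telescoping chains leave over; keeping them makes the induction close.\<close>
  have main: "(1 - \<beta>) * (\<Sum>i\<le>m. D i) + \<beta> * (D m + D (m - 1))
      \<le> D 0 + D 1 + \<eta> * (real (r m) + real (r (m - 1)) - real (r 0) - real (r 1))"
    using m rec
  proof (induction m rule: dec_induct)
    case base
    show ?case by (simp add: algebra_simps)
  next
    case (step m)
    then obtain i where i: "m = Suc i" by (cases m) auto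
    have "D (i + 2) \<le> \<beta> * D i + \<eta> * (real (r (i + 2)) - real (r i))"
      using step.prems[of i] i by simp
    moreover have "(1 - \<beta>) * (\<Sum>i\<le>m. D i) + \<beta> * (D m + D (m - 1))
      \<le> D 0 + D 1 + \<eta> * (real (r m) + real (r (m - 1)) - real (r 0) - real (r 1))"
      using step.IH step.prems by simp
    ultimately show ?case unfolding i by (simp add: algebra_simps)
  qed
  have \<eta>: "0 \<le> \<eta>" using D[of 0] by linarith
  have "\<eta> * (real (r m) + real (r (m - 1)) - real (r 0) - real (r 1)) \<le> \<eta> * (2 * real N)"
    using r[of m] r[of "m - 1"] \<eta> by (intro mult_left_mono) auto
  moreover have "0 \<le> \<beta> * (D m + D (m - 1))" using \<beta> D(1) by (intro mult_nonneg_nonneg) (auto intro: add_nonneg_nonneg)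
  moreover have "D 0 + D 1 \<le> 2 * \<eta>" using D(2)[of 0] D(2)[of 1] by linarith
  ultimately show ?thesis using main by (simp add: algebra_simps)
qed

text \<open>A factor \<open>\<beta>\<close> per two steps is a factor \<open>sqrt \<beta>\<close>
  per step. Summing the geometric tail bounds the distance to every later iterate, and the
  subsequence then identifies the limit.\<close>

lemma linear_rate_of_two_step_contraction:
  fixes w :: "nat \<Rightarrow> 'a::real_normed_vector"
  assumes \<beta>: "0 < \<beta>" "\<beta> < 1"
    and contr: "\<And>k. K \<le> k \<Longrightarrow> norm (w (k + 3) - w (k + 2)) \<le> \<beta> * norm (w (k + 1) - w k)"
    and r: "strict_mono r" "(w \<circ> r) \<longlonglongrightarrow> l"
  shows "\<exists>C q. 0 < q \<and> q < 1 \<and> (\<forall>k. norm (w k - l) \<le> C * q ^ k)"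
proof -
  define q where "q = sqrt \<beta>"
  have q: "0 < q" "q < 1" "q\<^sup>2 = \<beta>" using \<beta> by (auto simp: q_def)
  \<comment> \<open>The smaller power \<open>q ^ (K + 1)\<close> is used for both initial steps, so
    that one constant starts both chains.\<close>
  define M where "M = max (norm (w (K + 1) - w K)) (norm (w (K + 2) - w (K + 1))) / q ^ (K + 1)"
  have M0: "0 \<le> M" using q unfolding M_def by (auto simp: le_max_iff_disj)
  have Mq: "max (norm (w (K + 1) - w K)) (norm (w (K + 2) - w (K + 1))) = M * q ^ (K + 1)"
    using q unfolding M_def by simp
  have step: "norm (w (K + i + 1) - w (K + i)) \<le> M * q ^ (K + i)" for i
  proof (induction i rule: less_induct)
    case (less i)
    consider "i = 0" | "i = 1" | j where "i = j + 2"
      by (metis One_nat_def add_2_eq_Suc' not0_implies_Suc)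
    then show ?case
    proof cases
      case 1
      have "M * q ^ (K + 1) \<le> M * q ^ K" using q M0 by (intro mult_left_mono power_decreasing) auto
      then show ?thesis using Mq 1 by simp
    next
      case 2 then show ?thesis using Mq by (simp add: eval_nat_numeral)
    next
      case 3
      have "norm (w (K + i + 1) - w (K + i)) \<le> \<beta> * norm (w (K + j + 1) - w (K + j))"
        using contr[of "K + j"] 3 by (simp add: eval_nat_numeral)
      also have "\<dots> \<le> \<beta> * (M * q ^ (K + j))" using less[of j] 3 \<beta> by (intro mult_left_mono) auto
      also have "\<dots> = M * q ^ (K + i)" using 3 q(3) by (simp add: power_add power2_eq_square)
      finally show ?thesis .
    qed
  qed
  have tail: "norm (w (K + i + m) - w (K + i)) \<le> M * q ^ (K + i) * (1 - q ^ m) / (1 - q)" for i m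
  proof (induction m)
    case (Suc m)
    have "norm (w (K + i + Suc m) - w (K + i))
        \<le> norm (w (K + i + Suc m) - w (K + i + m)) + norm (w (K + i + m) - w (K + i))"
      using norm_triangle_ineq[of "w (K + i + Suc m) - w (K + i + m)" "w (K + i + m) - w (K + i)"] by simp
    also have "\<dots> \<le> M * q ^ (K + i + m) + M * q ^ (K + i) * (1 - q ^ m) / (1 - q)"
      using Suc step[of "i + m"] by (intro add_mono) (simp_all add: add.assoc)
    also have "\<dots> = M * q ^ (K + i) * (1 - q ^ Suc m) / (1 - q)"
      using q by (simp add: field_simps power_add)
    finally show ?case .
  qed simp
  have bound: "norm (w (K + i) - l) \<le> M / (1 - q) * q ^ (K + i)" for i
  proof (rule Lim_norm_ubound[OF _ tendsto_diff[OF tendsto_const r(2)]])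
    show "\<forall>\<^sub>F m in sequentially. norm (w (K + i) - (w \<circ> r) m) \<le> M / (1 - q) * q ^ (K + i)"
    proof (rule eventually_sequentiallyI[of "K + i"])
      fix m assume "K + i \<le> m"
      then obtain m' where m': "r m = K + i + m'"
        using seq_suble[OF r(1), of m] by (metis le_iff_add order_trans)
      have "norm (w (K + i) - (w \<circ> r) m) \<le> M * q ^ (K + i) * (1 - q ^ m') / (1 - q)"
        using tail[of i m'] m' by (simp add: norm_minus_commute)
      also have "\<dots> \<le> M * q ^ (K + i) * 1 / (1 - q)"
        using q M0 by (intro divide_right_mono mult_left_mono mult_nonneg_nonneg) auto
      finally show "norm (w (K + i) - (w \<circ> r) m) \<le> M / (1 - q) * q ^ (K + i)" by (simp add: field_simps)
    qed
  qed auto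
  \<comment> \<open>The added sum absorbs the finitely many iterates before
    \<open>K\<close>.\<close>
  define C where "C = M / (1 - q) + (\<Sum>i<K. norm (w i - l) / q ^ i)"
  have "norm (w k - l) \<le> C * q ^ k" for k
  proof (cases "k < K")
    case True
    have "norm (w k - l) / q ^ k \<le> (\<Sum>i<K. norm (w i - l) / q ^ i)"
      using True q by (intro member_le_sum) auto
    moreover have "0 \<le> M / (1 - q)" using M0 q by simp
    ultimately have "norm (w k - l) / q ^ k \<le> C" unfolding C_def by linarith
    then show ?thesis using q by (simp add: pos_divide_le_eq)
  next
    case False
    then have "norm (w k - l) \<le> M / (1 - q) * q ^ k" using bound[of "k - K"] by simp
    also have "\<dots> \<le> C * q ^ k"
      using q unfolding C_def by (intro mult_right_mono) (auto intro!: sum_nonneg)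
    finally show ?thesis .
  qed
  with q show ?thesis by blast
qed

section \<open>Boosted DC iterations for polyhedral data\<close>

text \<open>The quadratic term is removed from both components: \<open>e k\<close> stands for
  \<open>u k - \<rho> *\<^sub>R w k\<close>, \<open>e_sub\<close> is the subgradient condition for
  the polyhedral rest, and \<open>y_opt\<close> is the first-order condition of the subproblem. In
  \<open>\<theta>_form\<close>, \<open>\<Lambda>\<close> is the largest feasible step.\<close>

locale polyhedral_bdca =
  fixes A B :: "((real ^ 'n) \<times> real) set"
    and w y e :: "nat \<Rightarrow> real ^ 'n" and \<theta> :: "nat \<Rightarrow> real" and \<rho> \<beta> :: real and wbar :: "real ^ 'n"
    and \<phi> :: "real ^ 'n \<Rightarrow> real"
  assumes \<phi>_def: "\<phi> = (\<lambda>v. affine_max A v - affine_max B v)"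
    and A: "finite A" "A \<noteq> {}" and B: "finite B" "B \<noteq> {}"
    and \<rho>: "0 < \<rho>" and \<beta>: "0 < \<beta>" "\<beta> < 1"
    and w_in: "\<And>k. w k \<in> pf_simplex" and y_in: "\<And>k. y k \<in> pf_simplex"
    and y_opt: "\<And>k v. v \<in> pf_simplex \<Longrightarrow>
      affine_max A (y k) + (e k - \<rho> *\<^sub>R (y k - w k)) \<bullet> (v - y k) \<le> affine_max A v"
    and e_sub: "\<And>k v. affine_max B (w k) + e k \<bullet> (v - w k) \<le> affine_max B v"
    and step: "\<And>k. w (Suc k) = w k + \<theta> k *\<^sub>R (y k - w k)"
    and \<theta>_ge: "\<And>k. 1 \<le> \<theta> k"
    and \<theta>_form: "\<And>k. \<theta> k = 1 \<or> (\<exists>\<Lambda> j. \<theta> k = \<Lambda> * \<beta> ^ j \<and> w k + \<Lambda> *\<^sub>R (y k - w k) \<in> pf_simplex \<and>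
        (\<forall>l. w k + l *\<^sub>R (y k - w k) \<in> pf_simplex \<longrightarrow> l \<le> \<Lambda>))"
    and descent: "\<And>k. \<phi> (w (Suc k)) \<le> \<phi> (w k) - \<rho> * (norm (w (Suc k) - w k))\<^sup>2"
    and wbar_in: "wbar \<in> pf_simplex"
    and limit_point: "\<exists>r. strict_mono r \<and> (w \<circ> r) \<longlonglongrightarrow> wbar"
begin

lemma \<phi>_antimono: "k \<le> l \<Longrightarrow> \<phi> (w l) \<le> \<phi> (w k)"
proof (induction l rule: dec_induct)
  case (step l)
  moreover have "0 \<le> \<rho> * (norm (w (Suc l) - w l))\<^sup>2" using \<rho> by simp
  ultimately show ?case using descent[of l] by linarith
qed simp

lemma isCont_\<phi>: "isCont \<phi> v"
  unfolding \<phi>_def by (intro continuous_intros isCont_affine_max A B)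

lemma \<phi>_ge: "\<phi> wbar \<le> \<phi> (w k)"
proof -
  obtain r where r: "strict_mono r" "(w \<circ> r) \<longlonglongrightarrow> wbar" using limit_point by blast
  have "(\<lambda>i. \<phi> ((w \<circ> r) i)) \<longlonglongrightarrow> \<phi> wbar"
    by (rule isCont_tendsto_compose[OF isCont_\<phi> r(2)])
  moreover have "\<forall>\<^sub>F i in sequentially. \<phi> ((w \<circ> r) i) \<le> \<phi> (w k)"
    using seq_suble[OF r(1)] by (intro eventually_sequentiallyI[of k]) (auto intro!: \<phi>_antimono intro: order_trans)
  ultimately show ?thesis by (intro tendsto_upperbound) auto
qed

lemma step_le: "\<rho> * (norm (w (Suc k) - w k))\<^sup>2 \<le> \<phi> (w k) - \<phi> wbar"
  using descent[of k] \<phi>_ge[of "Suc k"] by linarith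

lemma direction_le_step: "norm (y k - w k) \<le> norm (w (Suc k) - w k)"
  using \<theta>_ge[of k] mult_right_mono[of 1 "\<theta> k" "norm (y k - w k)"] by (simp add: step)

text \<open>Once the value exceeds its limit by less than \<open>\<rho> * \<eta>\<^sup>2\<close>,
  the descent condition leaves no room for any later step longer than \<open>\<eta>\<close>.\<close>

lemma arbitrarily_close:
  assumes "0 < \<eta>"
  shows "\<exists>K. norm (w K - wbar) < \<eta> \<and> (\<forall>k\<ge>K. norm (w (Suc k) - w k) \<le> \<eta>)"
proof -
  obtain r where r: "strict_mono r" "(w \<circ> r) \<longlonglongrightarrow> wbar" using limit_point by blast
  have "(\<lambda>i. \<phi> ((w \<circ> r) i)) \<longlonglongrightarrow> \<phi> wbar"
    by (rule isCont_tendsto_compose[OF isCont_\<phi> r(2)])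
  then have "\<forall>\<^sub>F i in sequentially. \<phi> ((w \<circ> r) i) < \<phi> wbar + \<rho> * \<eta>\<^sup>2"
    using assms \<rho> by (intro order_tendstoD) auto
  moreover have "\<forall>\<^sub>F i in sequentially. dist ((w \<circ> r) i) wbar < \<eta>"
    using r(2) assms by (rule tendstoD)
  ultimately have "\<forall>\<^sub>F i in sequentially. \<phi> ((w \<circ> r) i) < \<phi> wbar + \<rho> * \<eta>\<^sup>2 \<and> dist ((w \<circ> r) i) wbar < \<eta>"
    by eventually_elim auto
  then obtain i where i: "\<phi> (w (r i)) < \<phi> wbar + \<rho> * \<eta>\<^sup>2" "dist (w (r i)) wbar < \<eta>"
    by (auto simp: eventually_sequentially)
  have "norm (w (Suc k) - w k) \<le> \<eta>" if "r i \<le> k" for k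
  proof -
    have "\<rho> * (norm (w (Suc k) - w k))\<^sup>2 \<le> \<rho> * \<eta>\<^sup>2"
      using step_le[of k] \<phi>_antimono[OF that] i(1) by linarith
    then have "(norm (w (Suc k) - w k))\<^sup>2 \<le> \<eta>\<^sup>2" using \<rho> by simp
    then show ?thesis by (rule power2_le_imp_le) (use assms in simp)
  qed
  with i(2) show ?thesis unfolding dist_norm by blast
qed

text \<open>At the limit value no descent is left, so the sequence is constant from \<open>K\<close>
  on and contracts trivially.\<close>

lemma linear_rate_if_terminating:
  assumes K: "\<phi> (w K) \<le> \<phi> wbar"
  shows "\<exists>C q. 0 < q \<and> q < 1 \<and> (\<forall>k. norm (w k - wbar) \<le> C * q ^ k)"
proof -
  obtain r where r: "strict_mono r" "(w \<circ> r) \<longlonglongrightarrow> wbar" using limit_point by blast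
  have stop: "w (Suc k) = w k" if "K \<le> k" for k
  proof -
    have "\<rho> * (norm (w (Suc k) - w k))\<^sup>2 \<le> 0"
      using step_le[of k] \<phi>_antimono[OF that] K by linarith
    with \<rho> show ?thesis by (simp add: mult_le_0_iff)
  qed
  show ?thesis
  proof (rule linear_rate_of_two_step_contraction[OF \<beta> _ r])
    fix k assume "K \<le> k"
    then show "norm (w (k + 3) - w (k + 2)) \<le> \<beta> * norm (w (k + 1) - w k)"
      using stop[of "k + 2"] stop[of k] by (simp add: eval_nat_numeral)
  qed
qed

text \<open>The polyhedral error bound at the limit point: if \<^term>\<open>\<phi> (y k) > \<phi> wbar\<close>, then the direction from
  any such point with the same active pieces and the same support towards \<^term>\<open>wbar\<close> is feasible at
  \<^term>\<open>y k\<close>, and optimality of \<^term>\<open>y k\<close> along it bounds the length of \<^term>\<open>y k - w k\<close> from below.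
  As there are only finitely many such classes of points, the bound is uniform.\<close>

lemma \<phi>_y_le_nearby:
  "\<exists>\<delta>>0. \<forall>k. w k \<in> ball wbar \<delta> \<and> y k \<in> ball wbar \<delta> \<and> norm (y k - w k) < \<delta> \<longrightarrow> \<phi> (y k) \<le> \<phi> wbar"
proof -
  obtain \<delta>1 where \<delta>1: "\<delta>1 > 0" "\<And>v. v \<in> ball wbar \<delta>1 \<Longrightarrow> active A v \<subseteq> active A wbar"
    using active_subset_nearby[OF A, of wbar] by blast
  obtain \<delta>2 where \<delta>2: "\<delta>2 > 0" "\<And>v. v \<in> ball wbar \<delta>2 \<Longrightarrow> active B v \<subseteq> active B wbar"
    using active_subset_nearby[OF B, of wbar] by blast
  \<comment> \<open>Active pieces and vanishing coordinates determine the slope towards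
    \<open>wbar\<close> and the feasibility of that direction.\<close>
  define cls where "cls = (\<lambda>v. (active A v, {i. v $ i = 0}))"
  define R where "R = {v \<in> pf_simplex \<inter> ball wbar \<delta>1. \<phi> wbar < \<phi> v}"
  define rep where "rep = (\<lambda>\<kappa>. SOME v. v \<in> R \<and> cls v = \<kappa>)"
  have rep: "rep (cls v) \<in> R \<and> cls (rep (cls v)) = cls v" if "v \<in> R" for v
    using someI[of "\<lambda>v'. v' \<in> R \<and> cls v' = cls v" v] that unfolding rep_def by blast
  \<comment> \<open>The lower bound on the length of \<open>y k - w k\<close> that the direction
    \<open>wbar - v\<close> yields.\<close>
  define bd where "bd = (\<lambda>v. (\<phi> v - \<phi> wbar) / (\<rho> * norm (wbar - v)))"
  have bd_pos: "0 < bd v" if "v \<in> R" for v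
    using that \<rho> unfolding R_def bd_def by (intro divide_pos_pos mult_pos_pos) auto
  have "cls ` R \<subseteq> Pow A \<times> UNIV" unfolding cls_def active_def by auto
  then have fin: "finite (cls ` R)" by (rule finite_subset) (use A in auto)
  define \<epsilon> where "\<epsilon> = Min (insert 1 (bd ` rep ` cls ` R))"
  have \<epsilon>: "0 < \<epsilon>" unfolding \<epsilon>_def using fin rep bd_pos by (subst Min_gr_iff) auto
  have \<epsilon>_le: "\<epsilon> \<le> bd (rep (cls v))" if "v \<in> R" for v
    unfolding \<epsilon>_def using that fin by (intro Min_le) auto
  define \<delta> where "\<delta> = min (min \<delta>1 \<delta>2) \<epsilon>"
  have "\<phi> (y k) \<le> \<phi> wbar"
    if k: "w k \<in> ball wbar \<delta>" "y k \<in> ball wbar \<delta>" "norm (y k - w k) < \<delta>" for k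
  proof (rule ccontr)
    assume "\<not> \<phi> (y k) \<le> \<phi> wbar"
    then have yR: "y k \<in> R" using y_in k(2) unfolding R_def \<delta>_def by auto
    define v where "v = rep (cls (y k))"
    have v: "v \<in> R" "active A v = active A (y k)" "{i. v $ i = 0} = {i. y k $ i = 0}"
      using rep[OF yR] unfolding v_def cls_def by auto
    \<comment> \<open>The direction is taken from the representative and not from
      \<open>y k\<close>, so only finitely many value gaps and lengths occur.\<close>
    define \<zeta> where "\<zeta> = wbar - v"
    have v_in: "v \<in> pf_simplex" using v(1) unfolding R_def by auto
    have "(\<Sum>i\<in>UNIV. \<zeta> $ i) = 0" unfolding \<zeta>_def by (rule sum_diff_pf_simplex[OF wbar_in v_in])
    moreover have "0 \<le> \<zeta> $ i" if "y k $ i = 0" for i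
    proof -
      have "v $ i = 0" using that v(3) by blast
      then show ?thesis using wbar_in unfolding \<zeta>_def by (simp add: pf_simplex_iff)
    qed
    ultimately obtain t1 where t1: "t1 > 0" "\<And>t. 0 \<le> t \<Longrightarrow> t \<le> t1 \<Longrightarrow> y k + t *\<^sub>R \<zeta> \<in> pf_simplex"
      using pf_simplex_feasible_direction[OF y_in[of k]] by blast
    have "active A v \<subseteq> active A wbar" using v(1) \<delta>1(2) unfolding R_def by auto
    then have "fst q \<bullet> \<zeta> = affine_max A wbar - affine_max A v" if "q \<in> active A (y k)" for q
      using that v(2) unfolding \<zeta>_def by (force simp: active_def inner_diff_right)
    from affine_max_along[OF A this] obtain t2 where t2: "t2 > 0"
      "\<And>t. 0 \<le> t \<Longrightarrow> t \<le> t2 \<Longrightarrow> affine_max A (y k + t *\<^sub>R \<zeta>) = affine_max A (y k) + t * (affine_max A wbar - affine_max A v)"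
      by blast
    define t where "t = min t1 t2"
    have t: "0 < t" "t \<le> t1" "t \<le> t2" using t1(1) t2(1) unfolding t_def by auto
    have "t * ((e k - \<rho> *\<^sub>R (y k - w k)) \<bullet> \<zeta>) \<le> t * (affine_max A wbar - affine_max A v)"
      using y_opt[OF t1(2)[of t], of k] t2(2)[of t] t by simp
    then have 1: "(e k - \<rho> *\<^sub>R (y k - w k)) \<bullet> \<zeta> \<le> affine_max A wbar - affine_max A v"
      using t(1) by simp
    \<comment> \<open>The subgradient at \<open>w k\<close> is also one at \<open>wbar\<close>; this
      controls the subtracted component along \<open>\<zeta>\<close>.\<close>
    have "active B (w k) \<subseteq> active B wbar" using k(1) \<delta>2(2) unfolding \<delta>_def by auto
    from subgradient_affine_max_limit[OF B this e_sub, of v]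
    have 2: "affine_max B wbar - affine_max B v \<le> e k \<bullet> \<zeta>" unfolding \<zeta>_def by (simp add: inner_diff_right)
    have "\<phi> v - \<phi> wbar \<le> \<rho> * ((y k - w k) \<bullet> \<zeta>)"
      using 1 2 unfolding \<phi>_def by (simp add: inner_diff_left)
    also have "\<dots> \<le> \<rho> * (norm (y k - w k) * norm \<zeta>)"
      using \<rho> by (intro mult_left_mono norm_cauchy_schwarz) auto
    finally have "\<phi> v - \<phi> wbar \<le> norm (y k - w k) * (\<rho> * norm \<zeta>)" by (simp add: mult_ac)
    moreover have "0 < \<rho> * norm \<zeta>" using v(1) \<rho> unfolding R_def \<zeta>_def by (intro mult_pos_pos) auto
    ultimately have "bd v \<le> norm (y k - w k)" unfolding bd_def \<zeta>_def by (simp add: pos_divide_le_eq)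
    with \<epsilon>_le[OF yR] k(3) show False unfolding v_def \<delta>_def by auto
  qed
  moreover have "\<delta> > 0" using \<delta>1(1) \<delta>2(1) \<epsilon> unfolding \<delta>_def by auto
  ultimately show ?thesis by blast
qed

lemma linear_rate_if_first_component_smooth:
  assumes "0 < \<delta>1" and affine: "\<And>v. v \<in> ball wbar \<delta>1 \<Longrightarrow> affine_max A v = affine_max A wbar + D \<bullet> (v - wbar)"
  shows "\<exists>C q. 0 < q \<and> q < 1 \<and> (\<forall>k. norm (w k - wbar) \<le> C * q ^ k)"
proof -
  obtain \<delta>2 where \<delta>2: "\<delta>2 > 0" "\<And>k. w k \<in> ball wbar \<delta>2 \<Longrightarrow> y k \<in> ball wbar \<delta>2 \<Longrightarrow>
      norm (y k - w k) < \<delta>2 \<Longrightarrow> \<phi> (y k) \<le> \<phi> wbar"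
    using \<phi>_y_le_nearby by blast
  define \<delta> where "\<delta> = min \<delta>1 \<delta>2"
  have \<delta>: "\<delta> > 0" using assms(1) \<delta>2(1) unfolding \<delta>_def by simp
  obtain K where K: "norm (w K - wbar) < \<delta> / 4" "norm (w (Suc K) - w K) \<le> \<delta> / 4"
    using arbitrarily_close[of "\<delta> / 4"] \<delta> by auto
  have d: "norm (y K - w K) \<le> \<delta> / 4" using direction_le_step[of K] K(2) by linarith
  have "norm (y K - wbar) < \<delta>" using norm_triangle_ineq[of "y K - w K" "w K - wbar"] d K(1) \<delta> by simp
  moreover have "norm (w (Suc K) - wbar) < \<delta>"
    using norm_triangle_ineq[of "w (Suc K) - w K" "w K - wbar"] K \<delta> by simp
  ultimately have near: "w K \<in> ball wbar \<delta>" "y K \<in> ball wbar \<delta>" "w (Suc K) \<in> ball wbar \<delta>"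
    using K(1) \<delta> by (auto simp: dist_norm norm_minus_commute)
  have y_le: "\<phi> (y K) \<le> \<phi> wbar"
    using near d \<delta> by (intro \<delta>2(2)) (auto simp: \<delta>_def)
  \<comment> \<open>As the step length is at least 1, \<open>y K\<close> is the convex combination
    of both iterates with weight \<open>s\<close> on the later one.\<close>
  define s where "s = 1 / \<theta> K"
  have s: "0 < s" "s \<le> 1" using \<theta>_ge[of K] unfolding s_def by auto
  have y_comb: "y K = (1 - s) *\<^sub>R w K + s *\<^sub>R w (Suc K)"
    using \<theta>_ge[of K] unfolding step s_def by (simp add: algebra_simps)
  have "affine_max B (y K) \<le> (1 - s) * affine_max B (w K) + s * affine_max B (w (Suc K))"
    unfolding y_comb using s by (intro convex_onD[OF convex_on_affine_max[OF B]]) auto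
  moreover have "affine_max A (y K) = (1 - s) * affine_max A (w K) + s * affine_max A (w (Suc K))"
  proof -
    have "affine_max A (y K) = affine_max A wbar + D \<bullet> (y K - wbar)"
      using near by (intro affine) (auto simp: \<delta>_def)
    moreover have "affine_max A (w K) = affine_max A wbar + D \<bullet> (w K - wbar)"
      using near by (intro affine) (auto simp: \<delta>_def)
    moreover have "affine_max A (w (Suc K)) = affine_max A wbar + D \<bullet> (w (Suc K) - wbar)"
      using near by (intro affine) (auto simp: \<delta>_def)
    moreover have "D \<bullet> y K = (1 - s) * (D \<bullet> w K) + s * (D \<bullet> w (Suc K))"
      unfolding y_comb by (simp add: inner_add_right)
    ultimately show ?thesis by (simp only: inner_diff_right) (simp add: algebra_simps)
  qed
  ultimately have conc: "(1 - s) * \<phi> (w K) + s * \<phi> (w (Suc K)) \<le> \<phi> (y K)"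
    unfolding \<phi>_def by (simp add: algebra_simps)
  have "\<phi> (w (Suc K)) \<le> \<phi> wbar"
  proof (rule ccontr)
    assume "\<not> \<phi> (w (Suc K)) \<le> \<phi> wbar"
    then have "s * \<phi> wbar < s * \<phi> (w (Suc K))" using s by simp
    moreover have "(1 - s) * \<phi> wbar \<le> (1 - s) * \<phi> (w K)"
      using s \<phi>_ge[of K] by (intro mult_left_mono) auto
    ultimately show False using conc y_le by (simp add: algebra_simps)
  qed
  then show ?thesis by (rule linear_rate_if_terminating)
qed

end

section \<open>The case of a smooth subtracted component\<close>

text \<open>\<open>g1\<close> and \<open>g2\<close> are the gradients of the two local pieces of
  \<open>\<phi>\<close>. The alternative to \<open>not_terminating\<close> is covered by
  \<open>linear_rate_if_terminating\<close>.\<close>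

locale polyhedral_bdca_smooth = polyhedral_bdca A B w y e \<theta> \<rho> \<beta> wbar \<phi>
  for A B :: "((real ^ 'n) \<times> real) set" and w y e \<theta> \<rho> \<beta> wbar \<phi> +
  fixes \<delta> :: real and c g1 g2 :: "real ^ 'n"
  assumes \<delta>: "0 < \<delta>"
    and B_affine: "\<And>v. v \<in> ball wbar \<delta> \<Longrightarrow> affine_max B v = affine_max B wbar + c \<bullet> (v - wbar)"
    and \<phi>_eq: "\<And>v. v \<in> pf_simplex \<Longrightarrow> v \<in> ball wbar \<delta> \<Longrightarrow>
        \<phi> v = \<phi> wbar + max (g1 \<bullet> (v - wbar)) (g2 \<bullet> (v - wbar))"
    and \<phi>_y_le: "\<And>k. w k \<in> ball wbar \<delta> \<Longrightarrow> y k \<in> ball wbar \<delta> \<Longrightarrow> norm (y k - w k) < \<delta> \<Longrightarrow>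
        \<phi> (y k) \<le> \<phi> wbar"
    and not_terminating: "\<And>k. \<phi> wbar < \<phi> (w k)"
begin

definition near :: "nat \<Rightarrow> bool" where
  "near k \<longleftrightarrow> w k \<in> ball wbar \<delta> \<and> y k \<in> ball wbar \<delta> \<and> w (Suc k) \<in> ball wbar \<delta> \<and> norm (y k - w k) < \<delta>"

lemma e_eq:
  assumes "w k \<in> ball wbar \<delta>"
  shows "e k = c"
proof (rule supporting_functional_eq_gradient)
  have "((\<lambda>v. affine_max B wbar + c \<bullet> (v - wbar)) has_derivative (\<lambda>t. c \<bullet> t)) (at (w k))"
    by (auto intro!: derivative_eq_intros)
  then show "(affine_max B has_derivative (\<lambda>t. c \<bullet> t)) (at (w k))"
    by (rule has_derivative_transform_within_open[OF _ open_ball assms]) (simp add: B_affine)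
qed (rule e_sub)

text \<open>Near \<open>wbar\<close> the subtracted component has gradient \<open>c\<close>, which
  equals \<open>e k\<close>. Subtracting it turns the optimality condition of the subproblem into
  that of a proximal step for \<open>\<phi>\<close> itself.\<close>

lemma y_opt_near:
  assumes k: "near k" and v: "v \<in> pf_simplex" "v \<in> ball wbar \<delta>"
  shows "\<phi> (y k) - \<rho> * ((y k - w k) \<bullet> (v - y k)) \<le> \<phi> v"
proof -
  have "affine_max A (y k) + (c - \<rho> *\<^sub>R (y k - w k)) \<bullet> (v - y k) \<le> affine_max A v"
    using y_opt[OF v(1), of k] e_eq[of k] k unfolding near_def by simp
  moreover have "affine_max B (y k) = affine_max B wbar + c \<bullet> (y k - wbar)"
    using k unfolding near_def by (intro B_affine) auto
  ultimately show ?thesis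
    using B_affine[OF v(2)] unfolding \<phi>_def by (simp add: inner_diff_left inner_diff_right algebra_simps)
qed

text \<open>In the proximal inequality at an index with \<open>w K\<close> close to
  \<open>wbar\<close> and a short step, the inner product is negligible and
  \<open>\<phi> (y K)\<close> is close to \<open>\<phi> wbar\<close>.\<close>

lemma \<phi>_ge_near:
  assumes v: "v \<in> pf_simplex" "v \<in> ball wbar \<delta>"
  shows "\<phi> wbar \<le> \<phi> v"
proof (rule field_le_epsilon)
  fix \<epsilon> :: real assume "0 < \<epsilon>"
  have "isCont (\<lambda>u. \<phi> u) wbar" by (rule isCont_\<phi>)
  then obtain s where s: "s > 0" "\<And>u. norm (u - wbar) < s \<Longrightarrow> \<bar>\<phi> u - \<phi> wbar\<bar> < \<epsilon> / 2"
    using \<open>0 < \<epsilon>\<close> unfolding continuous_at_eps_delta dist_norm real_norm_def by (metis half_gt_zero)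
  \<comment> \<open>The three bounds keep the points of the step inside the ball, keep
    \<open>\<phi> (y K)\<close> close to \<open>\<phi> wbar\<close>, and make the proximal term at
    most \<open>\<epsilon> / 4\<close>, where \<open>\<delta> + \<delta>\<close> bounds the distance
    from \<open>v\<close> to \<open>y K\<close>.\<close>
  define \<eta> where "\<eta> = min (min (\<delta> / 4) (s / 4)) (\<epsilon> / (4 * \<rho> * (\<delta> + \<delta>)))"
  have \<eta>: "0 < \<eta>" "\<eta> \<le> \<delta> / 4" "\<eta> \<le> s / 4" using \<delta> s(1) \<open>0 < \<epsilon>\<close> \<rho> unfolding \<eta>_def by auto
  obtain K where K: "norm (w K - wbar) < \<eta>" "norm (w (Suc K) - w K) \<le> \<eta>"
    using arbitrarily_close[OF \<eta>(1)] by blast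
  have d: "norm (y K - w K) \<le> \<eta>" using direction_le_step[of K] K(2) by linarith
  have yK: "norm (y K - wbar) < 2 * \<eta>" using norm_triangle_ineq[of "y K - w K" "w K - wbar"] d K(1) by simp
  have wK: "norm (w (Suc K) - wbar) < 2 * \<eta>"
    using norm_triangle_ineq[of "w (Suc K) - w K" "w K - wbar"] K by simp
  have near: "near K"
    using K(1) yK wK d \<eta> \<delta> unfolding near_def by (auto simp: dist_norm norm_minus_commute)
  have "norm (v - y K) \<le> norm (v - wbar) + norm (wbar - y K)"
    using norm_triangle_ineq[of "v - wbar" "wbar - y K"] by simp
  also have "\<dots> \<le> \<delta> + \<delta>"
    using v(2) yK \<eta> by (simp add: dist_norm norm_minus_commute)
  finally have vy: "norm (v - y K) \<le> \<delta> + \<delta>" .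
  have "\<rho> * ((y K - w K) \<bullet> (v - y K)) \<le> \<rho> * (norm (y K - w K) * norm (v - y K))"
    using \<rho> by (intro mult_left_mono norm_cauchy_schwarz) auto
  also have "\<dots> \<le> \<rho> * (\<eta> * (\<delta> + \<delta>))"
    using \<rho> d vy \<eta> by (intro mult_left_mono mult_mono) auto
  also have "\<dots> \<le> \<rho> * (\<epsilon> / (4 * \<rho> * (\<delta> + \<delta>)) * (\<delta> + \<delta>))"
    using \<rho> \<delta> unfolding \<eta>_def by (intro mult_left_mono mult_right_mono) auto
  also have "\<dots> = \<epsilon> / 4" using \<rho> \<delta> by (simp add: field_simps)
  finally have "\<rho> * ((y K - w K) \<bullet> (v - y K)) \<le> \<epsilon> / 4" .
  moreover have "\<bar>\<phi> (y K) - \<phi> wbar\<bar> < \<epsilon> / 2" using yK \<eta> s(1) by (intro s(2)) auto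
  ultimately show "\<phi> wbar \<le> \<phi> v + \<epsilon>" using y_opt_near[OF near v] \<open>0 < \<epsilon>\<close> by linarith
qed

context
  fixes k assumes k: "near k"
begin

lemma near_in_ball: "w k \<in> ball wbar \<delta>" "y k \<in> ball wbar \<delta>" "w (Suc k) \<in> ball wbar \<delta>"
  using k unfolding near_def by auto

lemma \<phi>_y: "\<phi> (y k) = \<phi> wbar"
  using \<phi>_y_le[of k] \<phi>_ge_near[OF y_in near_in_ball(2)] k unfolding near_def by auto

text \<open>A unit step would land on \<open>y k\<close>, which has the limit value.\<close>

lemma \<theta>_gt: "1 < \<theta> k"
proof (rule ccontr)
  assume "\<not> 1 < \<theta> k"
  then have "w (Suc k) = y k" using \<theta>_ge[of k] by (simp add: step)
  then show False using \<phi>_y not_terminating[of "Suc k"] by simp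
qed

lemma direction_nonzero: "y k \<noteq> w k"
  using \<phi>_y not_terminating[of k] by auto

lemma w_Suc: "w (Suc k) = y k + (\<theta> k - 1) *\<^sub>R (y k - w k)"
  by (simp add: step algebra_simps)

text \<open>Along the step, \<open>\<phi>\<close> is at least \<open>\<phi> wbar\<close>, with
  equality at \<open>y k\<close> and strict inequality at both ends, so
  \<open>two_piece_kink\<close> applies.\<close>

lemma kink: "g1 \<bullet> (y k - wbar) = 0 \<and> g2 \<bullet> (y k - wbar) = 0 \<and>
    (g1 \<bullet> (y k - w k) < 0 \<and> 0 < g2 \<bullet> (y k - w k) \<or> 0 < g1 \<bullet> (y k - w k) \<and> g2 \<bullet> (y k - w k) < 0)"
proof -
  let ?d = "y k - w k"
  have eq: "\<phi> v = \<phi> wbar + max (g1 \<bullet> (y k - wbar) + t * (g1 \<bullet> ?d)) (g2 \<bullet> (y k - wbar) + t * (g2 \<bullet> ?d))"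
    if "v = y k + t *\<^sub>R ?d" "v \<in> pf_simplex" "v \<in> ball wbar \<delta>" for v t
  proof -
    have "v - wbar = (y k - wbar) + t *\<^sub>R ?d" using that(1) by simp
    then have "g1 \<bullet> (v - wbar) = g1 \<bullet> (y k - wbar) + t * (g1 \<bullet> ?d)"
      "g2 \<bullet> (v - wbar) = g2 \<bullet> (y k - wbar) + t * (g2 \<bullet> ?d)"
      by (simp_all only: inner_add_right inner_scaleR_right)
    then show ?thesis using \<phi>_eq[OF that(2,3)] by simp
  qed
  show ?thesis
  proof (rule two_piece_kink[where l = "\<theta> k - 1"])
    show "max (g1 \<bullet> (y k - wbar)) (g2 \<bullet> (y k - wbar)) = 0"
      using eq[of "y k" 0] y_in near_in_ball \<phi>_y by simp
    show "0 < \<theta> k - 1" using \<theta>_gt by simp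
    show "0 < max (g1 \<bullet> (y k - wbar) - g1 \<bullet> ?d) (g2 \<bullet> (y k - wbar) - g2 \<bullet> ?d)"
      using eq[of "w k" "- 1"] w_in near_in_ball not_terminating[of k] by simp
    show "0 < max (g1 \<bullet> (y k - wbar) + (\<theta> k - 1) * (g1 \<bullet> ?d)) (g2 \<bullet> (y k - wbar) + (\<theta> k - 1) * (g2 \<bullet> ?d))"
      using eq[OF w_Suc w_in near_in_ball(3)] not_terminating[of "Suc k"] by linarith
    fix t assume t: "- 1 \<le> t" "t \<le> \<theta> k - 1"
    \<comment> \<open>Rescales the parameter so that the segment from \<open>w k\<close> to the next
      iterate becomes the unit interval, where convexity applies.\<close>
    define s where "s = (t + 1) / \<theta> k"
    have s: "0 \<le> s" "s \<le> 1" using t \<theta>_gt unfolding s_def by (auto simp: field_simps)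
    have st: "s * \<theta> k = t + 1" using \<theta>_gt unfolding s_def by simp
    have "y k + t *\<^sub>R ?d = w k + (t + 1) *\<^sub>R ?d" by (simp add: algebra_simps)
    also have "\<dots> = (1 - s) *\<^sub>R w k + s *\<^sub>R w (Suc k)"
      unfolding step st[symmetric] by (simp add: algebra_simps)
    finally have comb: "y k + t *\<^sub>R ?d = (1 - s) *\<^sub>R w k + s *\<^sub>R w (Suc k)" .
    have in1: "y k + t *\<^sub>R ?d \<in> pf_simplex"
      unfolding comb using s by (intro convexD[OF convex_pf_simplex] w_in) auto
    have in2: "y k + t *\<^sub>R ?d \<in> ball wbar \<delta>"
      unfolding comb using s near_in_ball by (intro convexD[OF convex_ball]) auto
    show "0 \<le> max (g1 \<bullet> (y k - wbar) + t * (g1 \<bullet> ?d)) (g2 \<bullet> (y k - wbar) + t * (g2 \<bullet> ?d))"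
      using eq[OF refl in1 in2] \<phi>_ge_near[OF in1 in2] by simp
  qed
qed

lemma y_projection:
  assumes v: "v \<in> pf_simplex" "v \<in> ball wbar \<delta>" "\<phi> v \<le> \<phi> wbar"
  shows "0 \<le> (y k - w k) \<bullet> (v - y k)"
proof -
  have "0 \<le> \<rho> * ((y k - w k) \<bullet> (v - y k))" using y_opt_near[OF k v(1,2)] v(3) \<phi>_y by linarith
  then show ?thesis using \<rho> by (simp add: zero_le_mult_iff)
qed

text \<open>The step goes strictly beyond \<^term>\<open>y k\<close>, so a coordinate that drops to zero there would become negative.\<close>

lemma support: "y k $ i = 0 \<Longrightarrow> w k $ i = 0"
proof -
  assume i: "y k $ i = 0"
  have "0 \<le> w (Suc k) $ i" "0 \<le> w k $ i" using w_in by (auto simp: pf_simplex_iff)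
  moreover have "w (Suc k) $ i = (1 - \<theta> k) * w k $ i" using i by (simp add: step algebra_simps)
  ultimately show ?thesis using \<theta>_gt by (auto simp: zero_le_mult_iff)
qed

text \<open>Both pieces vanish at \<open>y k\<close> by \<open>kink\<close>, so
  \<open>\<phi> - \<phi> wbar\<close> depends only on the displacement from
  \<open>y k\<close>.\<close>

lemma \<phi>_along:
  assumes v: "v = y k + t *\<^sub>R z" "v \<in> pf_simplex" "v \<in> ball wbar \<delta>"
  shows "\<phi> v = \<phi> wbar + max (t * (g1 \<bullet> z)) (t * (g2 \<bullet> z))"
proof -
  have "v - wbar = (y k - wbar) + t *\<^sub>R z" using v(1) by simp
  then have "g1 \<bullet> (v - wbar) = t * (g1 \<bullet> z)" "g2 \<bullet> (v - wbar) = t * (g2 \<bullet> z)"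
    using kink by (simp_all only: inner_add_right inner_scaleR_right)
  then show ?thesis using \<phi>_eq[OF v(2,3)] by simp
qed

lemma \<phi>_along_face:
  assumes sum: "(\<Sum>i\<in>UNIV. z $ i) = 0" and supp: "\<And>i. y k $ i = 0 \<Longrightarrow> z $ i = 0"
  shows "\<exists>t>0. y k + t *\<^sub>R z \<in> pf_simplex \<and> y k + t *\<^sub>R z \<in> ball wbar \<delta> \<and>
    \<phi> (y k + t *\<^sub>R z) = \<phi> wbar + t * max (g1 \<bullet> z) (g2 \<bullet> z)"
proof -
  obtain t1 where t1: "t1 > 0" "\<And>t. 0 \<le> t \<Longrightarrow> t \<le> t1 \<Longrightarrow> y k + t *\<^sub>R z \<in> pf_simplex"
    using pf_simplex_feasible_direction[OF y_in sum] supp by (metis order_refl)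
  obtain r where r: "r > 0" "ball (y k) r \<subseteq> ball wbar \<delta>"
    using near_in_ball(2) open_ball[of wbar \<delta>] unfolding open_contains_ball by blast
  define t where "t = min t1 (r / (2 * (norm z + 1)))"
  have pos: "0 < norm z + 1" using norm_ge_zero[of z] by linarith
  have t: "0 < t" "t \<le> t1" using t1(1) r(1) pos unfolding t_def by auto
  have "t * (norm z + 1) \<le> r / (2 * (norm z + 1)) * (norm z + 1)"
    unfolding t_def using pos by (intro mult_right_mono) auto
  also have "\<dots> = r / 2" using pos by (simp add: field_simps)
  finally have "t * norm z < r" using t(1) r(1) by (simp add: algebra_simps)
  then have "y k + t *\<^sub>R z \<in> ball (y k) r" using t(1) by (simp add: dist_norm)
  with r(2) have ball: "y k + t *\<^sub>R z \<in> ball wbar \<delta>" by blast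
  have simplex: "y k + t *\<^sub>R z \<in> pf_simplex" using t by (intro t1(2)) auto
  note \<phi>_along[OF refl simplex ball]
  moreover have "max (t * (g1 \<bullet> z)) (t * (g2 \<bullet> z)) = t * max (g1 \<bullet> z) (g2 \<bullet> z)"
    using t(1) by (simp add: max_def)
  ultimately show ?thesis using t(1) ball simplex by auto
qed

text \<open>On the face of \<^term>\<open>y k\<close> the two slopes are proportional, since \<^term>\<open>\<phi>\<close> is minimal at \<^term>\<open>y k\<close>.
  Hence the minimisers on that face form a hyperplane section, to which \<^term>\<open>y k - w k\<close> is orthogonal.\<close>

lemma direction_orthogonal:
  assumes sum: "(\<Sum>i\<in>UNIV. z $ i) = 0" and supp: "\<And>i. y k $ i = 0 \<Longrightarrow> z $ i = 0" and g1: "g1 \<bullet> z = 0"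
  shows "(y k - w k) \<bullet> z = 0"
proof -
  have nonneg: "0 \<le> max (g1 \<bullet> z) (g2 \<bullet> z)"
    if sum: "(\<Sum>i\<in>UNIV. z $ i) = 0" and supp: "\<And>i. y k $ i = 0 \<Longrightarrow> z $ i = 0" for z
  proof -
    obtain t where t: "t > 0" "y k + t *\<^sub>R z \<in> pf_simplex" "y k + t *\<^sub>R z \<in> ball wbar \<delta>"
      "\<phi> (y k + t *\<^sub>R z) = \<phi> wbar + t * max (g1 \<bullet> z) (g2 \<bullet> z)"
      using \<phi>_along_face[OF sum supp] by blast
    then have "0 \<le> t * max (g1 \<bullet> z) (g2 \<bullet> z)" using \<phi>_ge_near[OF t(2,3)] by linarith
    then show ?thesis using t(1) by (simp add: zero_le_mult_iff)
  qed
  \<comment> \<open>The sign orients the step direction so that the first piece falls and the second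
    one rises.\<close>
  obtain \<sigma> :: real where \<sigma>: "g1 \<bullet> (\<sigma> *\<^sub>R (y k - w k)) < 0" "0 < g2 \<bullet> (\<sigma> *\<^sub>R (y k - w k))"
    using kink that[of 1] that[of "- 1"] by (auto simp: inner_diff_right)
  define d' where "d' = \<sigma> *\<^sub>R (y k - w k)"
  have d'_sum: "(\<Sum>i\<in>UNIV. d' $ i) = 0"
    using sum_diff_pf_simplex[OF y_in w_in, of k k] unfolding d'_def by (simp flip: sum_distrib_left)
  have d'_supp: "d' $ i = 0" if "y k $ i = 0" for i
    using that support[OF that] unfolding d'_def by simp
  have no_neg: "\<not> g2 \<bullet> z < 0"
    if sum: "(\<Sum>i\<in>UNIV. z $ i) = 0" and supp: "\<And>i. y k $ i = 0 \<Longrightarrow> z $ i = 0" and g1: "g1 \<bullet> z = 0" for z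
  proof
    assume neg: "g2 \<bullet> z < 0"
    \<comment> \<open>Adding \<open>\<kappa> *\<^sub>R d'\<close> makes the first slope negative and
      uses up only half of the negative second slope, so \<open>\<phi>\<close> would fall below its
      local minimum.\<close>
    define \<kappa> where "\<kappa> = - (g2 \<bullet> z) / (2 * (g2 \<bullet> d'))"
    have \<kappa>: "0 < \<kappa>" using neg \<sigma>(2) unfolding \<kappa>_def d'_def by (simp add: divide_neg_pos)
    have "0 \<le> max (g1 \<bullet> (z + \<kappa> *\<^sub>R d')) (g2 \<bullet> (z + \<kappa> *\<^sub>R d'))"
    proof (rule nonneg)
      show "(\<Sum>i\<in>UNIV. (z + \<kappa> *\<^sub>R d') $ i) = 0"
        using sum d'_sum by (simp add: sum.distrib flip: sum_distrib_left)
    qed (use supp d'_supp in simp)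
    moreover have "g1 \<bullet> (z + \<kappa> *\<^sub>R d') < 0"
      using g1 \<kappa> \<sigma>(1) unfolding d'_def[symmetric] by (simp add: inner_add_right mult_pos_neg)
    moreover have "g2 \<bullet> (z + \<kappa> *\<^sub>R d') = (g2 \<bullet> z) / 2"
    proof -
      have "\<kappa> * (g2 \<bullet> d') = - (g2 \<bullet> z) / 2" using \<sigma>(2) unfolding d'_def[symmetric] \<kappa>_def by simp
      then show ?thesis by (simp add: inner_add_right)
    qed
    ultimately show False using neg by auto
  qed
  have sum': "(\<Sum>i\<in>UNIV. (- z) $ i) = 0" using sum by (simp add: sum_negf)
  have g2: "g2 \<bullet> z = 0"
    using no_neg[OF sum supp g1] no_neg[OF sum'] supp g1 by fastforce
  have dir: "0 \<le> (y k - w k) \<bullet> z"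
    if sum: "(\<Sum>i\<in>UNIV. z $ i) = 0" and supp: "\<And>i. y k $ i = 0 \<Longrightarrow> z $ i = 0"
      and g: "g1 \<bullet> z = 0" "g2 \<bullet> z = 0" for z
  proof -
    obtain t where t: "t > 0" "y k + t *\<^sub>R z \<in> pf_simplex" "y k + t *\<^sub>R z \<in> ball wbar \<delta>"
      "\<phi> (y k + t *\<^sub>R z) = \<phi> wbar + t * max (g1 \<bullet> z) (g2 \<bullet> z)"
      using \<phi>_along_face[OF sum supp] by blast
    then have "0 \<le> t * ((y k - w k) \<bullet> z)" using y_projection[OF t(2,3)] g by simp
    then show ?thesis using t(1) by (simp add: zero_le_mult_iff)
  qed
  show ?thesis using dir[OF sum supp g1 g2] dir[OF sum'] supp g1 g2 by fastforce
qed

end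

section \<open>Monotone slopes and contraction of the steps\<close>

definition slope :: "nat \<Rightarrow> real" where
  "slope k = \<bar>g1 \<bullet> (y k - w k)\<bar> / norm (y k - w k)"

text \<open>Subtracting the multiple of one direction that has the same \<open>g1\<close>-slope as
  the other leaves a vector in the common face that is orthogonal to both directions, hence zero. So
  the directions are parallel.\<close>

lemma slope_determined_by_support:
  assumes k: "near k" and l: "near l" and same: "{i. y k $ i = 0} = {i. y l $ i = 0}"
  shows "slope k = slope l"
proof -
  let ?d = "y k - w k" and ?d' = "y l - w l"
  have nz: "g1 \<bullet> ?d' \<noteq> 0" "?d' \<noteq> 0" using kink[OF l] by auto
  define m where "m = (g1 \<bullet> ?d) / (g1 \<bullet> ?d')"
  define z where "z = ?d - m *\<^sub>R ?d'"
  have sum: "(\<Sum>i\<in>UNIV. z $ i) = 0"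
    using sum_diff_pf_simplex[OF y_in w_in, of k k] sum_diff_pf_simplex[OF y_in w_in, of l l]
    unfolding z_def by (simp add: sum_subtractf flip: sum_distrib_left)
  have iff: "y k $ i = 0 \<longleftrightarrow> y l $ i = 0" for i using same by blast
  have supp: "z $ i = 0" if "y k $ i = 0" for i
    using that iff[of i] support[OF k that] support[OF l, of i] unfolding z_def by simp
  have g1: "g1 \<bullet> z = 0" using nz unfolding z_def m_def by (simp add: inner_diff_right)
  have "?d \<bullet> z = 0" using direction_orthogonal[OF k sum supp g1] by simp
  moreover have "?d' \<bullet> z = 0" using direction_orthogonal[OF l sum _ g1] supp iff by simp
  ultimately have "z \<bullet> z = 0" by (subst (1) z_def) (simp add: inner_diff_left)
  then have eq: "?d = m *\<^sub>R ?d'" unfolding z_def by simp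
  have "m \<noteq> 0" using eq direction_nonzero[OF k] by auto
  then show ?thesis unfolding slope_def eq by (simp add: abs_mult)
qed

lemma finite_slopes: "finite (slope ` {k. near k})"
proof -
  define F where "F = (\<lambda>T. slope (SOME k. near k \<and> {i. y k $ i = 0} = T))"
  have "slope k = F {i. y k $ i = 0}" if "near k" for k
    unfolding F_def
    using someI[of "\<lambda>l. near l \<and> {i. y l $ i = 0} = {i. y k $ i = 0}" k] that
    by (intro slope_determined_by_support) auto
  then have "slope ` {k. near k} \<subseteq> F ` UNIV" by auto
  then show ?thesis by (rule finite_subset) simp
qed

text \<open>The point \<^term>\<open>y (Suc k)\<close> is the minimiser of \<^term>\<open>\<phi>\<close> nearest to \<^term>\<open>w (Suc k)\<close>, and \<^term>\<open>y k\<close> is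
  one of its competitors.\<close>

lemma slope_mono:
  assumes k: "near k" and l: "near (Suc k)"
  shows "slope k \<le> slope (Suc k)" "slope k = slope (Suc k) \<Longrightarrow> y (Suc k) = y k"
proof -
  define d d' m where "d = y k - w k" and "d' = y (Suc k) - w (Suc k)" and "m = \<theta> k - 1"
  have m: "0 < m" using \<theta>_gt[OF k] unfolding m_def by simp
  have d: "0 < norm d" "0 < norm d'" using direction_nonzero[OF k] direction_nonzero[OF l] unfolding d_def d'_def by auto
  have diff: "y k - w (Suc k) = - (m *\<^sub>R d)" unfolding w_Suc[OF k] m_def d_def by simp
  have "0 \<le> d' \<bullet> (y k - y (Suc k))"
    unfolding d'_def using \<phi>_y[OF k] near_in_ball(2)[OF k] by (intro y_projection[OF l y_in]) auto
  \<comment> \<open>Law of cosines; the mixed term is nonnegative by the projection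
    inequality.\<close>
  moreover have "(norm (d' + (y k - y (Suc k))))\<^sup>2
      = (norm d')\<^sup>2 + 2 * (d' \<bullet> (y k - y (Suc k))) + (norm (y k - y (Suc k)))\<^sup>2"
    by (simp only: power2_norm_eq_inner inner_add_left inner_add_right inner_commute[of "y k - y (Suc k)" d'])
  moreover have "norm (y k - w (Suc k)) = norm (d' + (y k - y (Suc k)))" unfolding d'_def by simp
  ultimately have "(norm (y k - w (Suc k)))\<^sup>2 \<ge> (norm d')\<^sup>2 + (norm (y k - y (Suc k)))\<^sup>2"
    by (simp only:)
  then have sq: "(norm d')\<^sup>2 + (norm (y k - y (Suc k)))\<^sup>2 \<le> (m * norm d)\<^sup>2"
    unfolding diff using m by simp
  then have "(norm d')\<^sup>2 \<le> (m * norm d)\<^sup>2" by (smt (verit) zero_le_power2)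
  then have le: "norm d' \<le> m * norm d" by (rule power2_le_imp_le) (use m in simp)
  \<comment> \<open>The first piece vanishes at \<open>y k\<close> and at \<open>y (Suc k)\<close>,
    so its value at \<open>w (Suc k)\<close> can be computed from either point.\<close>
  have "g1 \<bullet> (w (Suc k) - wbar) = m * (g1 \<bullet> d)"
  proof -
    have "w (Suc k) - wbar = (y k - wbar) + m *\<^sub>R d" unfolding w_Suc[OF k] m_def d_def by simp
    then show ?thesis using kink[OF k] by (simp only: inner_add_right inner_scaleR_right)
  qed
  moreover have "g1 \<bullet> (w (Suc k) - wbar) = - (g1 \<bullet> d')"
    using kink[OF l] unfolding d'_def by (simp add: inner_diff_right)
  ultimately have g: "\<bar>g1 \<bullet> d'\<bar> = m * \<bar>g1 \<bullet> d\<bar>" using m by (metis abs_minus_cancel abs_mult abs_of_pos)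
  have pos: "0 < \<bar>g1 \<bullet> d\<bar>" using kink[OF k] unfolding d_def by auto
  have slopes: "slope k = \<bar>g1 \<bullet> d\<bar> / norm d" "slope (Suc k) = m * \<bar>g1 \<bullet> d\<bar> / norm d'"
    unfolding slope_def d_def[symmetric] d'_def[symmetric] g by auto
  have "\<bar>g1 \<bullet> d\<bar> * norm d' \<le> \<bar>g1 \<bullet> d\<bar> * (m * norm d)" using le by (intro mult_left_mono) auto
  then show "slope k \<le> slope (Suc k)" unfolding slopes using d by (simp add: field_simps)
  assume "slope k = slope (Suc k)"
  then have "\<bar>g1 \<bullet> d\<bar> * norm d' = \<bar>g1 \<bullet> d\<bar> * (m * norm d)" unfolding slopes using d by (simp add: field_simps)
  then have "norm d' = m * norm d" using pos by simp
  with sq show "y (Suc k) = y k" by simp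
qed

text \<open>Equal slopes fix \<open>y k\<close>. In multiples of \<open>d\<close> measured from this
  point, the four iterates sit at -1, \<open>m0\<close>, \<open>- \<mu>\<close> and
  \<open>m2 * \<mu>\<close>, and the line search is compared at the two visits of the negative
  side.\<close>

lemma step_sizes_contract:
  assumes near: "near k" "near (k + 1)" "near (k + 2)" and slope: "slope k = slope (k + 2)"
  shows "norm (w (k + 3) - w (k + 2)) \<le> \<beta> * norm (w (k + 1) - w k)"
proof -
  have near1: "near (Suc k)" and near2: "near (Suc (Suc k))" using near by simp_all
  have "slope k = slope (Suc k)" "slope (Suc k) = slope (Suc (Suc k))"
    using slope_mono(1)[OF near(1) near1] slope_mono(1)[OF near1 near2] slope by auto
  then have y1: "y (Suc k) = y k" and y2: "y (Suc (Suc k)) = y k"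
    using slope_mono(2)[OF near(1) near1] slope_mono(2)[OF near1 near2] by auto
  define d m0 m1 m2 \<mu> where "d = y k - w k" and "m0 = \<theta> k - 1" and "m1 = \<theta> (Suc k) - 1"
    and "m2 = \<theta> (Suc (Suc k)) - 1" and "\<mu> = m1 * m0"
  have m: "0 < m0" "0 < m1" "0 < m2"
    using \<theta>_gt[OF near(1)] \<theta>_gt[OF near1] \<theta>_gt[OF near2] unfolding m0_def m1_def m2_def by auto
  then have \<mu>: "0 < \<mu>" unfolding \<mu>_def by simp
  have w1: "w (Suc k) = y k + m0 *\<^sub>R d" unfolding w_Suc[OF near(1)] m0_def d_def by simp
  have w2: "w (Suc (Suc k)) = y k + (- \<mu>) *\<^sub>R d"
    unfolding w_Suc[OF near1] y1 w1 m1_def[symmetric] \<mu>_def by simp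
  have d2: "y (Suc (Suc k)) - w (Suc (Suc k)) = \<mu> *\<^sub>R d" unfolding y2 w2 by simp
  have w3: "w (Suc (Suc (Suc k))) = y k + (m2 * \<mu>) *\<^sub>R d"
    using w_Suc[OF near2, unfolded d2, unfolded y2] unfolding m2_def by simp
  have w0: "w k = y k + (- 1) *\<^sub>R d" unfolding d_def by simp
  note line = \<phi>_along[OF near(1), where z = d]
  define M M' where "M = max (g1 \<bullet> d) (g2 \<bullet> d)" and "M' = max (- (g1 \<bullet> d)) (- (g2 \<bullet> d))"
  have M: "0 < M" "0 < M'" using kink[OF near(1)] unfolding M_def M'_def d_def[symmetric] by auto
  have \<phi>0: "\<phi> (w k) = \<phi> wbar + M'"
    using line[OF w0 w_in near_in_ball(1)[OF near(1)]] unfolding M'_def by simp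
  have \<phi>2: "\<phi> (w (Suc (Suc k))) = \<phi> wbar + \<mu> * M'"
    using line[OF w2 w_in near_in_ball(1)[OF near2]] \<mu> unfolding M'_def by (auto simp: max_def)
  have \<phi>1: "\<phi> (w (Suc k)) = \<phi> wbar + m0 * M"
    using line[OF w1 w_in near_in_ball(1)[OF near1]] m unfolding M_def by (auto simp: max_def)
  have "0 < m2 * \<mu>" using m \<mu> by simp
  then have \<phi>3: "\<phi> (w (Suc (Suc (Suc k)))) = \<phi> wbar + m2 * \<mu> * M"
    using line[OF w3 w_in near_in_ball(3)[OF near2]] unfolding M_def by (simp add: max_mult_distrib_left)
  \<comment> \<open>On one side of \<open>y k\<close> the value is proportional to the distance, so
    monotone values give monotone distances.\<close>
  have "\<mu> * M' \<le> 1 * M'" using \<phi>_antimono[of k "Suc (Suc k)"] \<phi>0 \<phi>2 by simp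
  then have \<mu>_le: "\<mu> \<le> 1" using M by simp
  have "w (Suc (Suc k)) - w (Suc k) = - ((\<mu> + m0) *\<^sub>R d)" unfolding w1 w2 by (simp add: algebra_simps)
  moreover have "d \<noteq> 0" using direction_nonzero[OF near(1)] unfolding d_def by simp
  ultimately have "0 < \<rho> * (norm (w (Suc (Suc k)) - w (Suc k)))\<^sup>2" using \<rho> m \<mu> by simp
  then have "\<phi> (w (Suc (Suc (Suc k)))) < \<phi> (w (Suc k))"
    using descent[of "Suc k"] \<phi>_antimono[of "Suc (Suc k)" "Suc (Suc (Suc k))"] by simp
  then have less: "m2 * \<mu> < m0" using \<phi>1 \<phi>3 M by simp
  obtain \<Lambda> j where \<Lambda>: "\<theta> k = \<Lambda> * \<beta> ^ j" "w k + \<Lambda> *\<^sub>R d \<in> pf_simplex"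
    "\<And>l. w k + l *\<^sub>R d \<in> pf_simplex \<Longrightarrow> l \<le> \<Lambda>"
    using \<theta>_form[of k] \<theta>_gt[OF near(1)] unfolding d_def by fastforce
  obtain \<Lambda>' j' where \<Lambda>': "\<theta> (Suc (Suc k)) = \<Lambda>' * \<beta> ^ j'" "w (Suc (Suc k)) + \<Lambda>' *\<^sub>R \<mu> *\<^sub>R d \<in> pf_simplex"
    "\<And>l. w (Suc (Suc k)) + l *\<^sub>R \<mu> *\<^sub>R d \<in> pf_simplex \<Longrightarrow> l \<le> \<Lambda>'"
    using \<theta>_form[of "Suc (Suc k)"] \<theta>_gt[OF near2] unfolding d2 by fastforce
  \<comment> \<open>Expresses feasibility at the later visit in the coordinate of the earlier one;
    both largest steps then reach the same boundary point.\<close>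
  have shift: "w (Suc (Suc k)) + l *\<^sub>R \<mu> *\<^sub>R d = w k + (l * \<mu> + 1 - \<mu>) *\<^sub>R d" for l
    unfolding w2 w0 by (simp add: algebra_simps)
  have "\<Lambda>' * \<mu> + 1 - \<mu> \<le> \<Lambda>" using \<Lambda>(3) \<Lambda>'(2) unfolding shift by blast
  moreover have "(\<Lambda> + \<mu> - 1) / \<mu> \<le> \<Lambda>'"
    by (rule \<Lambda>'(3), subst shift) (use \<Lambda>(2) \<mu> in simp)
  ultimately have rel: "\<Lambda>' * \<mu> = \<Lambda> + \<mu> - 1" using \<mu> by (simp add: divide_le_eq)
  have "1 \<le> \<Lambda>" using \<Lambda>(3)[of 1] y_in[of k] unfolding d_def by simp
  moreover have "(\<Lambda>' * \<beta> ^ j' - 1) * \<mu> < \<Lambda> * \<beta> ^ j - 1"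
    using less unfolding \<Lambda>(1)[symmetric] \<Lambda>'(1)[symmetric] m0_def m2_def .
  ultimately have "\<theta> (Suc (Suc k)) * \<mu> \<le> \<beta> * \<theta> k"
    using backtracking_contraction[OF \<beta> \<mu> \<mu>_le _ rel] unfolding \<Lambda>(1) \<Lambda>'(1) by blast
  then have "\<theta> (Suc (Suc k)) * \<mu> * norm d \<le> \<beta> * \<theta> k * norm d" by (intro mult_right_mono) auto
  moreover have "norm (w (k + 3) - w (k + 2)) = \<theta> (Suc (Suc k)) * \<mu> * norm d"
    using step[of "Suc (Suc k)"] d2 \<mu> \<theta>_ge[of "Suc (Suc k)"] by (simp add: eval_nat_numeral)
  moreover have "norm (w (k + 1) - w k) = \<theta> k * norm d"
    using step[of k] \<theta>_ge[of k] unfolding d_def by simp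
  ultimately show ?thesis by simp
qed

text \<open>An integer substitute for the slope: it is bounded and gains at least one at every
  strict increase, so increases can be counted.\<close>

definition slope_rank :: "nat \<Rightarrow> nat" where
  "slope_rank k = card {s \<in> slope ` {k. near k}. s < slope k}"

lemma slope_rank_le: "slope_rank k \<le> card (slope ` {k. near k})"
  unfolding slope_rank_def using finite_slopes by (intro card_mono) auto

lemma slope_rank_less:
  assumes "near k" "slope k < slope l"
  shows "slope_rank k < slope_rank l"
  unfolding slope_rank_def using assms finite_slopes by (intro psubset_card_mono) auto

lemma slope_rank_mono: "slope k \<le> slope l \<Longrightarrow> slope_rank k \<le> slope_rank l"
  unfolding slope_rank_def using finite_slopes by (intro card_mono) auto

lemma slope_le_two_steps:
  assumes "near k" "near (k + 1)" "near (k + 2)"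
  shows "slope k \<le> slope (k + 2)"
  using slope_mono(1)[of k] slope_mono(1)[of "Suc k"] assms by fastforce

text \<open>Either the slope is unchanged and the steps contract, or the rank grows and the last
  term alone pays for a step of length at most \<open>\<eta>\<close>.\<close>

lemma step_sizes_recursion:
  assumes near: "near k" "near (k + 1)" "near (k + 2)"
    and \<eta>: "norm (w (k + 3) - w (k + 2)) \<le> \<eta>"
  shows "norm (w (k + 3) - w (k + 2)) \<le> \<beta> * norm (w (k + 1) - w k) + \<eta> * (real (slope_rank (k + 2)) - real (slope_rank k))"
proof (cases "slope k = slope (k + 2)")
  case True
  then have "slope_rank (k + 2) = slope_rank k" unfolding slope_rank_def by simp
  then show ?thesis using step_sizes_contract[OF near True] by simp
next
  case False
  then have "slope_rank k < slope_rank (k + 2)" using slope_le_two_steps[OF near] near(1) by (intro slope_rank_less) auto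
  then have "1 \<le> real (slope_rank (k + 2)) - real (slope_rank k)" by linarith
  moreover have "0 \<le> \<eta>" using \<eta> norm_ge_zero order_trans by blast
  ultimately have "\<eta> * 1 \<le> \<eta> * (real (slope_rank (k + 2)) - real (slope_rank k))" by (intro mult_left_mono)
  moreover have "0 \<le> \<beta> * norm (w (k + 1) - w k)" using \<beta> by simp
  ultimately show ?thesis using \<eta> by linarith
qed

text \<open>A trapping argument by strong induction: while all earlier indices are near, the
  recursion bounds the total path length, so the next iterate cannot leave the ball.\<close>

lemma eventually_near: "\<exists>K. \<forall>k. near (K + k)"
proof -
  define N where "N = card (slope ` {k. near k})"
  \<comment> \<open>Two initial steps and at most \<open>2 * N\<close> rank jumps, each costing
    \<open>\<eta>\<close>, must stay below \<open>\<delta> / 8\<close> after division by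
    \<open>1 - \<beta>\<close>.\<close>
  define \<eta> where "\<eta> = min (\<delta> / 16) ((1 - \<beta>) * \<delta> / (8 * (2 + 2 * real N)))"
  have \<eta>: "0 < \<eta>" "\<eta> \<le> \<delta> / 16" using \<delta> \<beta> unfolding \<eta>_def by (simp, intro min.cobounded1)
  have \<eta>2: "(2 + 2 * real N) * \<eta> \<le> (1 - \<beta>) * (\<delta> / 8)"
  proof -
    have "(2 + 2 * real N) * \<eta> \<le> (2 + 2 * real N) * ((1 - \<beta>) * \<delta> / (8 * (2 + 2 * real N)))"
      unfolding \<eta>_def by (intro mult_left_mono) auto
    also have "\<dots> = (1 - \<beta>) * (\<delta> / 8)" by (simp add: field_simps)
    finally show ?thesis .
  qed
  obtain K where K: "norm (w K - wbar) < \<eta>" "\<And>k. K \<le> k \<Longrightarrow> norm (w (Suc k) - w k) \<le> \<eta>"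
    using arbitrarily_close[OF \<eta>(1)] by blast
  define D where "D = (\<lambda>i. norm (w (Suc (K + i)) - w (K + i)))"
  have D: "0 \<le> D i" "D i \<le> \<eta>" for i using K(2)[of "K + i"] unfolding D_def by auto
  have travel: "norm (w (K + k) - w K) \<le> (\<Sum>i<k. D i)" for k
  proof (induction k)
    case (Suc k)
    have "norm (w (K + Suc k) - w K) \<le> D k + norm (w (K + k) - w K)"
      using norm_triangle_ineq[of "w (K + Suc k) - w (K + k)" "w (K + k) - w K"] unfolding D_def by simp
    with Suc show ?case by simp
  qed simp
  have "near (K + k)" for k
  proof (induction k rule: less_induct)
    case (less k)
    have total: "(\<Sum>i<k. D i) \<le> \<delta> / 8"
    proof (cases "k \<le> 1")
      case True
      then have "k = 0 \<or> k = 1" by auto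
      then have "(\<Sum>i<k. D i) \<le> \<eta>" using D(2)[of 0] \<eta>(1) by (auto simp: less_eq_real_def)
      then show ?thesis using \<eta> by linarith
    next
      case False
      then obtain m where m: "k = Suc m" "1 \<le> m" by (cases k) auto
      have "(1 - \<beta>) * (\<Sum>i\<le>m. D i) \<le> (2 + 2 * real N) * \<eta>"
      proof (rule geometric_sum_bound_with_jumps[OF \<beta> D _ m(2), where r = "\<lambda>i. slope_rank (K + i)"])
        show "slope_rank (K + i) \<le> N" for i unfolding N_def by (rule slope_rank_le)
        fix i assume i: "i + 2 \<le> m"
        have "near (K + i)" "near (K + i + 1)" "near (K + i + 2)"
          using less[of i] less[of "i + 1"] less[of "i + 2"] i m by (simp_all add: add.assoc)
        from step_sizes_recursion[OF this, of \<eta>]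
        show "D (i + 2) \<le> \<beta> * D i + \<eta> * (real (slope_rank (K + (i + 2))) - real (slope_rank (K + i)))"
          using D(2)[of "i + 2"] unfolding D_def by (simp add: eval_nat_numeral)
      qed
      then have "(1 - \<beta>) * (\<Sum>i\<le>m. D i) \<le> (1 - \<beta>) * (\<delta> / 8)" using \<eta>2 by linarith
      then have "(\<Sum>i\<le>m. D i) \<le> \<delta> / 8" using \<beta> by simp
      then show ?thesis unfolding m lessThan_Suc_atMost .
    qed
    have w: "norm (w (K + k) - wbar) < \<delta> / 4"
      using norm_triangle_ineq[of "w (K + k) - w K" "w K - wbar"] travel[of k] total K(1) \<eta> by simp
    have w': "norm (w (Suc (K + k)) - w (K + k)) \<le> \<delta> / 16" using K(2)[of "K + k"] \<eta> by simp
    then have d: "norm (y (K + k) - w (K + k)) \<le> \<delta> / 16" using direction_le_step[of "K + k"] by linarith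
    have "norm (y (K + k) - wbar) < \<delta>"
      using norm_triangle_ineq[of "y (K + k) - w (K + k)" "w (K + k) - wbar"] w d \<delta> by simp
    moreover have "norm (w (Suc (K + k)) - wbar) < \<delta>"
      using norm_triangle_ineq[of "w (Suc (K + k)) - w (K + k)" "w (K + k) - wbar"] w w' \<delta> by simp
    ultimately show ?case
      using w d \<delta> unfolding near_def by (auto simp: dist_norm norm_minus_commute)
  qed
  then show ?thesis by blast
qed

text \<open>The rank is monotone and bounded, so it stays at its maximum from some index on; from
  there no slope increases and every pair of steps contracts.\<close>

lemma linear_rate: "\<exists>C q. 0 < q \<and> q < 1 \<and> (\<forall>k. norm (w k - wbar) \<le> C * q ^ k)"
proof -
  obtain K where K: "\<And>k. near (K + k)" using eventually_near by blast
  have near: "near k" if "K \<le> k" for k using K[of "k - K"] that by simp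
  obtain k0 where k0: "\<And>k. slope_rank (K + k) \<le> slope_rank (K + k0)"
    using ex_has_greatest_nat[of "\<lambda>_. True" 0 "\<lambda>k. slope_rank (K + k)" "Suc (card (slope ` {k. near k}))"]
      slope_rank_le by (auto simp: less_Suc_eq_le)
  have mono: "slope_rank (K + k0) \<le> slope_rank k" if "K + k0 \<le> k" for k
    using that
  proof (induction k rule: dec_induct)
    case (step k)
    have "slope_rank k \<le> slope_rank (Suc k)" using step near by (intro slope_rank_mono slope_mono(1)) auto
    with step show ?case by simp
  qed simp
  obtain r where r: "strict_mono r" "(w \<circ> r) \<longlonglongrightarrow> wbar" using limit_point by blast
  show ?thesis
  proof (rule linear_rate_of_two_step_contraction[OF \<beta> _ r])
    fix k assume k: "K + k0 \<le> k"
    have nears: "near k" "near (k + 1)" "near (k + 2)" using k near by auto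
    have "\<not> slope k < slope (k + 2)"
      using slope_rank_less[OF nears(1)] mono[OF k] k0[of "k + 2 - K"] k by fastforce
    then show "norm (w (k + 3) - w (k + 2)) \<le> \<beta> * norm (w (k + 1) - w k)"
      using slope_le_two_steps[OF nears] by (intro step_sizes_contract nears) auto
  qed
qed

end

section \<open>Discrete conditional value-at-risk\<close>

definition sorts :: "nat \<Rightarrow> (nat \<Rightarrow> real ^ 'n) \<Rightarrow> real ^ 'n \<Rightarrow> (nat \<Rightarrow> nat) \<Rightarrow> bool" where
  "sorts S x v \<sigma> \<longleftrightarrow> \<sigma> permutes {..<S} \<and> (\<forall>i j. i \<le> j \<and> j < S \<longrightarrow> v \<bullet> x (\<sigma> i) \<le> v \<bullet> x (\<sigma> j))"

definition tail_count :: "nat \<Rightarrow> (nat \<Rightarrow> real) \<Rightarrow> real \<Rightarrow> (nat \<Rightarrow> nat) \<Rightarrow> nat" where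
  "tail_count S p a \<sigma> = Max {k. k \<le> S \<and> (\<Sum>j<k. p (\<sigma> j)) < a}"

text \<open>The mass that the tail of level \<open>a\<close> takes from scenario \<open>i\<close>.
  The ordering is an argument because ties admit several orderings at one point.\<close>

definition tail_weight :: "nat \<Rightarrow> (nat \<Rightarrow> real) \<Rightarrow> real \<Rightarrow> (nat \<Rightarrow> nat) \<Rightarrow> nat \<Rightarrow> real" where
  "tail_weight S p a \<sigma> i =
    (if i \<in> \<sigma> ` {..<tail_count S p a \<sigma>} then p i
     else if i = \<sigma> (tail_count S p a \<sigma>) then a - (\<Sum>j<tail_count S p a \<sigma>. p (\<sigma> j)) else 0)"

lemma sorts_sort_perm: "sorts S x v (sort_perm S x v)"
proof -
  define f where "f = (\<lambda>i. v \<bullet> x i)"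
  define L where "L = sort_key f [0..<S]"
  have L: "length L = S" "distinct L" "set L = {..<S}" "sorted (map f L)"
    unfolding L_def by (auto simp: atLeast0LessThan)
  define \<sigma> where "\<sigma> = (\<lambda>i. if i < S then L ! i else i)"
  have "inj_on ((!) L) {..<S}" using L(1,2) by (simp add: inj_on_nth)
  moreover have "(!) L ` {..<S} = {..<S}"
    using L(1,3) by (auto simp: set_conv_nth image_iff)
  ultimately have "bij_betw ((!) L) {..<S} {..<S}" by (simp add: bij_betw_def)
  moreover have "bij_betw ((!) L) {..<S} {..<S} = bij_betw \<sigma> {..<S} {..<S}"
    by (rule bij_betw_cong) (simp add: \<sigma>_def)
  ultimately have "bij_betw \<sigma> {..<S} {..<S}" by simp
  then have "\<sigma> permutes {..<S}" by (rule bij_imp_permutes) (simp add: \<sigma>_def)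
  moreover have "v \<bullet> x (\<sigma> i) \<le> v \<bullet> x (\<sigma> j)" if "i \<le> j" "j < S" for i j
    using sorted_nth_mono[OF L(4), of i j] that L(1) unfolding \<sigma>_def f_def by simp
  ultimately have "\<exists>\<sigma>. \<sigma> permutes {..<S} \<and> (\<forall>i j. i \<le> j \<and> j < S \<longrightarrow> v \<bullet> x (\<sigma> i) \<le> v \<bullet> x (\<sigma> j))"
    by blast
  then show ?thesis unfolding sorts_def sort_perm_def by (rule someI_ex)
qed

locale scenario_probs =
  fixes S :: nat and p :: "nat \<Rightarrow> real"
  assumes p_nonneg: "\<And>j. j < S \<Longrightarrow> 0 \<le> p j" and p_sum: "(\<Sum>j<S. p j) = 1"
begin

text \<open>The dual feasible set of the tail functional: \<open>a * cvar S x p a v\<close> is the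
  least weighted return over it.\<close>

definition feasible_weights :: "real \<Rightarrow> (nat \<Rightarrow> real) \<Rightarrow> bool" where
  "feasible_weights a q \<longleftrightarrow> (\<forall>i<S. 0 \<le> q i \<and> q i \<le> p i) \<and> (\<Sum>i<S. q i) = a"

context
  fixes \<sigma> :: "nat \<Rightarrow> nat"
  assumes perm: "\<sigma> permutes {..<S}"
begin

lemma perm_less: "\<sigma> j < S \<longleftrightarrow> j < S"
  using permutes_in_image[OF perm, of j] by simp

lemma partial_sum_mono: "k \<le> l \<Longrightarrow> l \<le> S \<Longrightarrow> (\<Sum>j<k. p (\<sigma> j)) \<le> (\<Sum>j<l. p (\<sigma> j))"
  by (intro sum_mono2) (auto intro!: p_nonneg simp: perm_less)

lemma sum_perm: "(\<Sum>i<S. f i) = (\<Sum>j<S. f (\<sigma> j))" for f :: "nat \<Rightarrow> 'b::comm_monoid_add"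
  using sum.permute[OF perm, of f] by (simp add: o_def)

lemma tail_count:
  assumes a: "0 < a" "a < 1"
  shows "tail_count S p a \<sigma> < S" "(\<Sum>j<tail_count S p a \<sigma>. p (\<sigma> j)) < a"
    "a \<le> (\<Sum>j<Suc (tail_count S p a \<sigma>). p (\<sigma> j))"
proof -
  let ?K = "{k. k \<le> S \<and> (\<Sum>j<k. p (\<sigma> j)) < a}" and ?k = "tail_count S p a \<sigma>"
  have fin: "finite ?K" by simp
  have "0 \<in> ?K" using a by simp
  then have "?k \<in> ?K" unfolding tail_count_def using fin by (intro Max_in) auto
  then have k: "?k \<le> S" "(\<Sum>j<?k. p (\<sigma> j)) < a" by auto
  have "?k \<noteq> S" using k(2) a sum_perm[of p] p_sum by auto
  with k show "?k < S" "(\<Sum>j<?k. p (\<sigma> j)) < a" by auto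
  show "a \<le> (\<Sum>j<Suc ?k. p (\<sigma> j))"
  proof (rule ccontr)
    assume "\<not> ?thesis"
    then have "Suc ?k \<in> ?K" using \<open>?k < S\<close> by simp
    then have "Suc ?k \<le> ?k" unfolding tail_count_def using fin by (intro Max_ge) auto
    then show False by simp
  qed
qed

lemma tail_count_eqI:
  assumes k: "k < S" "(\<Sum>j<k. p (\<sigma> j)) < a" "a \<le> (\<Sum>j<Suc k. p (\<sigma> j))"
  shows "tail_count S p a \<sigma> = k"
  unfolding tail_count_def
proof (rule Max_eqI)
  fix l assume "l \<in> {k. k \<le> S \<and> (\<Sum>j<k. p (\<sigma> j)) < a}"
  then show "l \<le> k" using partial_sum_mono[of "Suc k" l] k(3) by fastforce
qed (use k in auto)

lemma tail_weight_perm: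
  "tail_weight S p a \<sigma> (\<sigma> j) = (if j < tail_count S p a \<sigma> then p (\<sigma> j)
    else if j = tail_count S p a \<sigma> then a - (\<Sum>j<tail_count S p a \<sigma>. p (\<sigma> j)) else 0)"
  using permutes_inj[OF perm] unfolding tail_weight_def by (auto simp: inj_eq inj_image_mem_iff)

lemma sum_tail_weight:
  fixes f :: "nat \<Rightarrow> real"
  assumes a: "0 < a" "a < 1"
  defines "k \<equiv> tail_count S p a \<sigma>"
  shows "(\<Sum>i<S. tail_weight S p a \<sigma> i * f i)
    = (\<Sum>j<k. p (\<sigma> j) * f (\<sigma> j)) + (a - (\<Sum>j<k. p (\<sigma> j))) * f (\<sigma> k)"
proof -
  have "(\<Sum>i<S. tail_weight S p a \<sigma> i * f i) = (\<Sum>j<S. tail_weight S p a \<sigma> (\<sigma> j) * f (\<sigma> j))"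
    by (rule sum_perm)
  also have "\<dots> = (\<Sum>j<Suc k. tail_weight S p a \<sigma> (\<sigma> j) * f (\<sigma> j))"
    using tail_count(1)[OF a] unfolding k_def by (intro sum.mono_neutral_right) (auto simp: tail_weight_perm)
  also have "\<dots> = (\<Sum>j<k. p (\<sigma> j) * f (\<sigma> j)) + (a - (\<Sum>j<k. p (\<sigma> j))) * f (\<sigma> k)"
    by (simp add: tail_weight_perm k_def)
  finally show ?thesis .
qed

lemma feasible_tail_weight:
  assumes a: "0 < a" "a < 1"
  shows "feasible_weights a (tail_weight S p a \<sigma>)"
proof -
  have "0 \<le> tail_weight S p a \<sigma> i \<and> tail_weight S p a \<sigma> i \<le> p i" if i: "i < S" for i
  proof -
    obtain j where "i = \<sigma> j" using permutes_surj[OF perm] by (metis surjD)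
    then show ?thesis
      using p_nonneg[OF i] tail_count[OF a] by (auto simp: tail_weight_perm)
  qed
  moreover have "(\<Sum>i<S. tail_weight S p a \<sigma> i) = a"
    using sum_tail_weight[OF a, of "\<lambda>_. 1"] by simp
  ultimately show ?thesis unfolding feasible_weights_def by blast
qed

text \<open>Compare all returns with that of the fractional scenario. Below this threshold the tail
  weights are full, above it they are zero, so every product is nonnegative; equal total mass
  removes the threshold.\<close>

lemma tail_weight_minimal:
  fixes z :: "nat \<Rightarrow> real"
  assumes a: "0 < a" "a < 1" and q: "feasible_weights a q"
    and sorted: "\<And>i j. i \<le> j \<Longrightarrow> j < S \<Longrightarrow> z (\<sigma> i) \<le> z (\<sigma> j)"
  shows "(\<Sum>i<S. tail_weight S p a \<sigma> i * z i) \<le> (\<Sum>i<S. q i * z i)"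
proof -
  define k where "k = tail_count S p a \<sigma>"
  have "0 \<le> (\<Sum>i<S. (q i - tail_weight S p a \<sigma> i) * (z i - z (\<sigma> k)))"
  proof (rule sum_nonneg)
    fix i assume "i \<in> {..<S}"
    then have i: "i < S" by simp
    obtain j where j: "i = \<sigma> j" using permutes_surj[OF perm] by (metis surjD)
    have "j < S" using i perm_less unfolding j by simp
    have qi: "0 \<le> q i" "q i \<le> p i" using q i unfolding feasible_weights_def by auto
    consider "j < k" | "j = k" | "k < j" by linarith
    then show "0 \<le> (q i - tail_weight S p a \<sigma> i) * (z i - z (\<sigma> k))"
    proof cases
      case 1
      have "z i \<le> z (\<sigma> k)" using sorted[of j k] 1 tail_count(1)[OF a] unfolding j k_def by simp
      moreover have "tail_weight S p a \<sigma> i = p i" using 1 unfolding j k_def tail_weight_perm by simp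
      ultimately show ?thesis using qi by (intro mult_nonpos_nonpos) auto
    next
      case 2 then show ?thesis using j by simp
    next
      case 3
      have "z (\<sigma> k) \<le> z i" using sorted[of k j] 3 \<open>j < S\<close> unfolding j by simp
      moreover have "tail_weight S p a \<sigma> i = 0" using 3 unfolding j k_def tail_weight_perm by simp
      ultimately show ?thesis using qi by simp
    qed
  qed
  also have "\<dots> = (\<Sum>i<S. q i * z i) - (\<Sum>i<S. tail_weight S p a \<sigma> i * z i)
      - ((\<Sum>i<S. q i) - (\<Sum>i<S. tail_weight S p a \<sigma> i)) * z (\<sigma> k)"
    by (simp add: algebra_simps sum_subtractf sum.distrib sum_distrib_left)
  finally show ?thesis using q feasible_tail_weight[OF a] unfolding feasible_weights_def by simp
qed

end

lemma scaled_cvar_sort_perm: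
  assumes a: "0 < a" "a < 1"
  shows "a * cvar S x p a v = (\<Sum>i<S. tail_weight S p a (sort_perm S x v) i * (v \<bullet> x i))"
proof -
  have perm: "sort_perm S x v permutes {..<S}" using sorts_sort_perm unfolding sorts_def by blast
  show ?thesis unfolding sum_tail_weight[OF perm a]
    using a by (simp add: cvar_def cvar_eps_def cvar_k_def tail_count_def Let_def distrib_left)
qed

lemma scaled_cvar_le:
  assumes a: "0 < a" "a < 1" and q: "feasible_weights a q"
  shows "a * cvar S x p a v \<le> (\<Sum>i<S. q i * (v \<bullet> x i))"
  unfolding scaled_cvar_sort_perm[OF a]
  using sorts_sort_perm[of S x v] unfolding sorts_def by (intro tail_weight_minimal[OF _ a q]) auto

text \<open>Any two sorting permutations yield minimal weights, so the way ties are broken does not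
  affect the value.\<close>

lemma scaled_cvar_eq:
  assumes a: "0 < a" "a < 1" and \<sigma>: "sorts S x v \<sigma>"
  shows "a * cvar S x p a v = (\<Sum>i<S. tail_weight S p a \<sigma> i * (v \<bullet> x i))"
proof (rule antisym)
  have perm: "\<sigma> permutes {..<S}" using \<sigma> unfolding sorts_def by blast
  show "a * cvar S x p a v \<le> (\<Sum>i<S. tail_weight S p a \<sigma> i * (v \<bullet> x i))"
    by (rule scaled_cvar_le[OF a feasible_tail_weight[OF perm a]])
  show "(\<Sum>i<S. tail_weight S p a \<sigma> i * (v \<bullet> x i)) \<le> a * cvar S x p a v"
    unfolding scaled_cvar_sort_perm[OF a]
  proof (rule tail_weight_minimal[OF perm a])
    show "feasible_weights a (tail_weight S p a (sort_perm S x v))"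
      using sorts_sort_perm[of S x v] unfolding sorts_def by (intro feasible_tail_weight a) auto
  qed (use \<sigma> in \<open>auto simp: sorts_def\<close>)
qed

text \<open>One linear piece per permutation, negated because the tail functional is
  concave.\<close>

definition cvar_pieces :: "(nat \<Rightarrow> real ^ 'n) \<Rightarrow> real \<Rightarrow> ((real ^ 'n) \<times> real) set" where
  "cvar_pieces x a = (\<lambda>\<sigma>. (- (\<Sum>i<S. tail_weight S p a \<sigma> i *\<^sub>R x i), 0)) ` {\<sigma>. \<sigma> permutes {..<S}}"

lemma finite_cvar_pieces: "finite (cvar_pieces x a)" "cvar_pieces x a \<noteq> {}"
  unfolding cvar_pieces_def using permutes_id[of "{..<S}"] by (auto simp: finite_permutations simp del: permutes_id)

lemma affine_max_cvar_pieces: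
  assumes a: "0 < a" "a < 1"
  shows "affine_max (cvar_pieces x a) v = - (a * cvar S x p a v)"
proof (rule affine_max_eqI[OF finite_cvar_pieces(1)])
  have eq: "- (\<Sum>i<S. tail_weight S p a \<sigma> i *\<^sub>R x i) \<bullet> v = - (\<Sum>i<S. tail_weight S p a \<sigma> i * (v \<bullet> x i))" for \<sigma>
    by (simp add: inner_sum_left inner_sum_right inner_commute)
  fix q assume "q \<in> cvar_pieces x a"
  then obtain \<sigma> where \<sigma>: "\<sigma> permutes {..<S}" "q = (- (\<Sum>i<S. tail_weight S p a \<sigma> i *\<^sub>R x i), 0)"
    unfolding cvar_pieces_def by blast
  then show "fst q \<bullet> v + snd q \<le> - (a * cvar S x p a v)"
    using scaled_cvar_le[OF a feasible_tail_weight[OF \<sigma>(1) a], of x v] eq[of \<sigma>] by simp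
next
  let ?q = "(- (\<Sum>i<S. tail_weight S p a (sort_perm S x v) i *\<^sub>R x i), 0::real)"
  show "?q \<in> cvar_pieces x a"
    using sorts_sort_perm[of S x v] unfolding cvar_pieces_def sorts_def by blast
  show "fst ?q \<bullet> v + snd ?q = - (a * cvar S x p a v)"
    unfolding scaled_cvar_sort_perm[OF a] by (simp add: inner_sum_left inner_sum_right inner_commute)
qed

text \<open>If the scenario carrying the fractional tail weight ties with another scenario of positive
  probability, then shifting a little weight between the two gives a second supporting functional.\<close>

lemma tied_scenarios_equal:
  fixes x :: "nat \<Rightarrow> real ^ 'n"
  assumes a: "0 < a" "a < 1" and \<sigma>: "sorts S x v \<sigma>"
    and D: "(affine_max (cvar_pieces x a) has_derivative (\<lambda>t. D \<bullet> t)) (at v)"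
    and frac: "a < (\<Sum>j<Suc (tail_count S p a \<sigma>). p (\<sigma> j))"
    and l: "l < S" "0 < p l" and tie: "v \<bullet> x l = v \<bullet> x (\<sigma> (tail_count S p a \<sigma>))"
  shows "x l = x (\<sigma> (tail_count S p a \<sigma>))"
proof -
  define j where "j = \<sigma> (tail_count S p a \<sigma>)"
  let ?q = "tail_weight S p a \<sigma>"
  have perm: "\<sigma> permutes {..<S}" using \<sigma> unfolding sorts_def by blast
  have jS: "j < S" using tail_count(1)[OF perm a] perm_less[OF perm] unfolding j_def by simp
  have qj: "0 < ?q j" "?q j < p j"
    using tail_count(2)[OF perm a] frac unfolding j_def tail_weight_perm[OF perm] by auto
  \<comment> \<open>Weights attaining the minimum at \<open>v\<close> define a supporting
    functional, and differentiability admits only one.\<close>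
  have unique: "- (\<Sum>i<S. q i *\<^sub>R x i) = D"
    if q: "feasible_weights a q" and eq: "(\<Sum>i<S. q i * (v \<bullet> x i)) = a * cvar S x p a v" for q
  proof (rule supporting_functional_eq_gradient[OF D])
    fix v'
    have inner: "(\<Sum>i<S. q i *\<^sub>R x i) \<bullet> u = (\<Sum>i<S. q i * (u \<bullet> x i))" for u
      by (simp add: inner_sum_left inner_sum_right inner_commute)
    have "- (\<Sum>i<S. q i *\<^sub>R x i) \<bullet> (v' - v) = (\<Sum>i<S. q i * (v \<bullet> x i)) - (\<Sum>i<S. q i * (v' \<bullet> x i))"
      by (simp add: inner inner_diff_right)
    then show "affine_max (cvar_pieces x a) v + - (\<Sum>i<S. q i *\<^sub>R x i) \<bullet> (v' - v) \<le> affine_max (cvar_pieces x a) v'"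
      using scaled_cvar_le[OF a q, of x v'] eq unfolding affine_max_cvar_pieces[OF a] by simp
  qed
  have feas: "feasible_weights a ?q" by (rule feasible_tail_weight[OF perm a])
  show ?thesis
  proof (cases "l = j")
    case True then show ?thesis unfolding j_def by simp
  next
    case False
    obtain i where i: "l = \<sigma> i" using permutes_surj[OF perm] by (metis surjD)
    \<comment> \<open>Only \<open>j\<close> carries fractional weight. An empty \<open>l\<close> can
      receive mass from \<open>j\<close>, a full one can give mass to it; this fixes the sign of
      \<open>s\<close>.\<close>
    have "?q l = 0 \<or> ?q l = p l" using False unfolding i j_def tail_weight_perm[OF perm] by auto
    then obtain s where s: "s \<noteq> 0" "0 \<le> ?q j - s" "?q j - s \<le> p j" "0 \<le> ?q l + s" "?q l + s \<le> p l"
    proof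
      assume "?q l = 0"
      then show ?thesis using qj l that[of "min (?q j) (p l)"] by (auto simp: min_def)
    next
      assume "?q l = p l"
      then show ?thesis using qj l that[of "- min (p j - ?q j) (p l)"] by (auto simp: min_def)
    qed
    define q where "q = (\<lambda>i. ?q i + (if i = l then s else 0) - (if i = j then s else 0))"
    have sum_q: "(\<Sum>i<S. q i *\<^sub>R f i) = (\<Sum>i<S. ?q i *\<^sub>R f i) + s *\<^sub>R f l - s *\<^sub>R f j"
      for f :: "nat \<Rightarrow> 'b::real_vector"
    proof -
      have "(\<Sum>i<S. q i *\<^sub>R f i) = (\<Sum>i<S. ?q i *\<^sub>R f i + (if i = l then s *\<^sub>R f i else 0) - (if i = j then s *\<^sub>R f i else 0))"
        unfolding q_def by (intro sum.cong refl) (auto simp: algebra_simps)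
      then show ?thesis using jS l(1) by (simp add: sum.distrib sum_subtractf)
    qed
    have "feasible_weights a q"
    proof -
      have "0 \<le> q i \<and> q i \<le> p i" if "i < S" for i
        using feas s False that unfolding feasible_weights_def q_def by auto
      moreover have "(\<Sum>i<S. q i) = a"
        using sum_q[of "\<lambda>_. 1::real"] feas unfolding feasible_weights_def by simp
      ultimately show ?thesis unfolding feasible_weights_def by blast
    qed
    moreover have "(\<Sum>i<S. q i * (v \<bullet> x i)) = a * cvar S x p a v"
      using sum_q[of "\<lambda>i. v \<bullet> x i"] tie scaled_cvar_eq[OF a \<sigma>] unfolding j_def by simp
    ultimately have "- (\<Sum>i<S. q i *\<^sub>R x i) = D" by (rule unique)
    moreover have "- (\<Sum>i<S. ?q i *\<^sub>R x i) = D"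
      using scaled_cvar_eq[OF a \<sigma>] by (intro unique[OF feas]) simp
    ultimately have "(\<Sum>i<S. ?q i *\<^sub>R x i) + s *\<^sub>R x l - s *\<^sub>R x j = (\<Sum>i<S. ?q i *\<^sub>R x i)"
      using sum_q[of x] by (metis neg_equal_iff_equal)
    then have "s *\<^sub>R (x l - x j) = 0" by (simp add: algebra_simps)
    then show ?thesis using s(1) unfolding j_def by simp
  qed
qed

text \<open>Strict inequalities at \<open>z\<close> survive nearby, so an ordering of a nearby point
  differs from one at \<open>z\<close> at most in how ties are broken.\<close>

lemma sort_perm_sorts_nearby:
  fixes x :: "nat \<Rightarrow> real ^ 'n"
  shows "\<exists>\<delta>>0. \<forall>v\<in>ball z \<delta>. sorts S x z (sort_perm S x v)"
proof -
  have "\<forall>\<^sub>F v in nhds z. z \<bullet> x i < z \<bullet> x j \<longrightarrow> v \<bullet> x i < v \<bullet> x j" for i j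
  proof (cases "z \<bullet> x i < z \<bullet> x j")
    case True
    have "((\<lambda>v. v \<bullet> x j - v \<bullet> x i) \<longlongrightarrow> z \<bullet> x j - z \<bullet> x i) (nhds z)"
      by (intro tendsto_intros filterlim_ident)
    from order_tendstoD(1)[OF this, of 0] True show ?thesis by (auto elim!: eventually_mono)
  qed auto
  then have "\<forall>\<^sub>F v in nhds z. \<forall>i\<in>{..<S}. \<forall>j\<in>{..<S}. z \<bullet> x i < z \<bullet> x j \<longrightarrow> v \<bullet> x i < v \<bullet> x j"
    by (simp add: eventually_ball_finite_distrib)
  then obtain \<delta> where \<delta>: "\<delta> > 0"
    "\<And>v i j. dist v z < \<delta> \<Longrightarrow> i < S \<Longrightarrow> j < S \<Longrightarrow> z \<bullet> x i < z \<bullet> x j \<Longrightarrow> v \<bullet> x i < v \<bullet> x j"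
    unfolding eventually_nhds_metric by auto
  have "sorts S x z (sort_perm S x v)" if v: "v \<in> ball z \<delta>" for v
  proof -
    let ?\<sigma> = "sort_perm S x v"
    have \<sigma>: "?\<sigma> permutes {..<S}" "\<And>i j. i \<le> j \<Longrightarrow> j < S \<Longrightarrow> v \<bullet> x (?\<sigma> i) \<le> v \<bullet> x (?\<sigma> j)"
      using sorts_sort_perm[of S x v] unfolding sorts_def by auto
    have "z \<bullet> x (?\<sigma> i) \<le> z \<bullet> x (?\<sigma> j)" if ij: "i \<le> j" "j < S" for i j
      using \<sigma>(2)[OF ij] \<delta>(2)[of v "?\<sigma> j" "?\<sigma> i"] v ij perm_less[OF \<sigma>(1)]
      by (force simp: dist_commute not_le[symmetric])
    with \<sigma>(1) show ?thesis unfolding sorts_def by blast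
  qed
  with \<delta>(1) show ?thesis by blast
qed

text \<open>Lowering the level by less than the fractional mass takes weight from the fractional
  scenario alone.\<close>

lemma cvar_difference:
  assumes \<alpha>: "0 < \<alpha>" "\<alpha> < 1" and \<gamma>: "0 < \<gamma>" and \<sigma>: "\<sigma> permutes {..<S}"
    and eps: "\<gamma> < \<alpha> - (\<Sum>j<tail_count S p \<alpha> \<sigma>. p (\<sigma> j))"
  shows "0 < \<alpha> - \<gamma>" "tail_count S p (\<alpha> - \<gamma>) \<sigma> = tail_count S p \<alpha> \<sigma>"
    "(\<Sum>i<S. tail_weight S p \<alpha> \<sigma> i * f i) - (\<Sum>i<S. tail_weight S p (\<alpha> - \<gamma>) \<sigma> i * f i)
      = \<gamma> * f (\<sigma> (tail_count S p \<alpha> \<sigma>))"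
proof -
  note tc = tail_count[OF \<sigma> \<alpha>]
  have "0 \<le> (\<Sum>j<tail_count S p \<alpha> \<sigma>. p (\<sigma> j))"
    using tc(1) perm_less[OF \<sigma>] by (intro sum_nonneg p_nonneg) auto
  then show pos: "0 < \<alpha> - \<gamma>" using eps by linarith
  show eq: "tail_count S p (\<alpha> - \<gamma>) \<sigma> = tail_count S p \<alpha> \<sigma>"
    using tc eps \<gamma> by (intro tail_count_eqI[OF \<sigma>]) auto
  show "(\<Sum>i<S. tail_weight S p \<alpha> \<sigma> i * f i) - (\<Sum>i<S. tail_weight S p (\<alpha> - \<gamma>) \<sigma> i * f i)
      = \<gamma> * f (\<sigma> (tail_count S p \<alpha> \<sigma>))"
    using sum_tail_weight[OF \<sigma> \<alpha>, of f] sum_tail_weight[OF \<sigma> pos, of f] \<alpha> \<gamma> unfolding eq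
    by (simp add: algebra_simps)
qed

text \<open>The difference is \<open>\<gamma>\<close> times the return of the fractional scenario.
  Nearby this scenario may change, but the new one ties at \<open>z\<close> with the old one, and
  then both have the same vector.\<close>

lemma value_at_risk_locally_linear:
  fixes x :: "nat \<Rightarrow> real ^ 'n"
  assumes \<alpha>: "0 < \<alpha>" "\<alpha> < 1" and \<gamma>: "0 < \<gamma>" "\<And>v. \<gamma> < cvar_eps S x p \<alpha> v"
    and D: "(affine_max (cvar_pieces x (\<alpha> - \<gamma>)) has_derivative (\<lambda>t. D \<bullet> t)) (at z)"
  shows "\<exists>\<delta>>0. \<exists>\<xi>. \<forall>v\<in>ball z \<delta>. \<alpha> * cvar S x p \<alpha> v - (\<alpha> - \<gamma>) * cvar S x p (\<alpha> - \<gamma>) v = \<gamma> * (v \<bullet> \<xi>)"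
proof -
  obtain \<delta> where \<delta>: "\<delta> > 0" "\<And>v. v \<in> ball z \<delta> \<Longrightarrow> sorts S x z (sort_perm S x v)"
    using sort_perm_sorts_nearby by blast
  define k where "k = (\<lambda>v. tail_count S p \<alpha> (sort_perm S x v))"
  have perm: "sort_perm S x v permutes {..<S}" for v using sorts_sort_perm unfolding sorts_def by blast
  have eps: "\<gamma> < \<alpha> - (\<Sum>j<tail_count S p \<alpha> (sort_perm S x v). p (sort_perm S x v j))" for v
    using \<gamma>(2)[of v] by (simp add: cvar_eps_def cvar_k_def tail_count_def Let_def)
  note diff = cvar_difference[OF \<alpha> \<gamma>(1) perm eps]
  have a: "0 < \<alpha> - \<gamma>" "\<alpha> - \<gamma> < 1" using diff(1) \<alpha> \<gamma>(1) by auto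
  define \<xi> where "\<xi> = x (sort_perm S x z (k z))"
  have "\<alpha> * cvar S x p \<alpha> v - (\<alpha> - \<gamma>) * cvar S x p (\<alpha> - \<gamma>) v = \<gamma> * (v \<bullet> \<xi>)" if v: "v \<in> ball z \<delta>" for v
  proof -
    let ?l = "sort_perm S x v (k v)"
    have "\<gamma> * (z \<bullet> x ?l) = \<alpha> * cvar S x p \<alpha> z - (\<alpha> - \<gamma>) * cvar S x p (\<alpha> - \<gamma>) z"
      using diff(3)[of v "\<lambda>i. z \<bullet> x i"] scaled_cvar_eq[OF \<alpha> \<delta>(2)[OF v]] scaled_cvar_eq[OF a \<delta>(2)[OF v]]
      unfolding k_def by simp
    moreover have "\<gamma> * (z \<bullet> \<xi>) = \<alpha> * cvar S x p \<alpha> z - (\<alpha> - \<gamma>) * cvar S x p (\<alpha> - \<gamma>) z"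
      using diff(3)[of z "\<lambda>i. z \<bullet> x i"] unfolding scaled_cvar_sort_perm[OF \<alpha>] scaled_cvar_sort_perm[OF a] k_def \<xi>_def
      by simp
    ultimately have tie: "z \<bullet> x ?l = z \<bullet> \<xi>" using \<gamma>(1) by (metis mult_left_cancel less_irrefl)
    note tc = tail_count[OF perm[of v] \<alpha>] and tz = tail_count[OF perm[of z] \<alpha>]
    have l: "?l < S" "0 < p ?l" using tc(1,2,3) perm_less[OF perm] unfolding k_def by auto
    have "x ?l = x (sort_perm S x z (tail_count S p (\<alpha> - \<gamma>) (sort_perm S x z)))"
    proof (rule tied_scenarios_equal[OF a sorts_sort_perm D _ l])
      \<comment> \<open>At the lower level the scenario is used strictly partially, which leaves
        room to shift mass both ways.\<close>
      show "\<alpha> - \<gamma> < (\<Sum>j<Suc (tail_count S p (\<alpha> - \<gamma>) (sort_perm S x z)). p (sort_perm S x z j))"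
        unfolding diff(2) using tz(3) \<gamma>(1) by linarith
      show "z \<bullet> x ?l = z \<bullet> x (sort_perm S x z (tail_count S p (\<alpha> - \<gamma>) (sort_perm S x z)))"
        using tie unfolding diff(2) \<xi>_def k_def .
    qed
    then have "x ?l = \<xi>" unfolding diff(2) \<xi>_def k_def .
    then show ?thesis
      using diff(3)[of v "\<lambda>i. v \<bullet> x i"] unfolding scaled_cvar_sort_perm[OF \<alpha>] scaled_cvar_sort_perm[OF a] k_def
      by simp
  qed
  with \<delta>(1) show ?thesis by blast
qed

end

section \<open>The line search\<close>

lemma bdca_stepsize:
  fixes w d :: "real ^ 'n"
  assumes w: "w \<in> pf_simplex" and y: "w + d \<in> pf_simplex" and d: "d \<noteq> 0" and \<beta>: "0 < \<beta>" "\<beta> < 1"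
    and dec: "\<phi> (w + d) \<le> \<phi> w - \<rho> * (norm d)\<^sup>2"
  defines "\<theta> \<equiv> bdca_stepsize \<phi> \<rho> \<beta> w d"
  shows "1 \<le> \<theta>" "w + \<theta> *\<^sub>R d \<in> pf_simplex" "\<phi> (w + \<theta> *\<^sub>R d) \<le> \<phi> w - \<rho> * \<theta>\<^sup>2 * (norm d)\<^sup>2"
    "\<theta> = 1 \<or> (\<exists>\<Lambda> j. \<theta> = \<Lambda> * \<beta> ^ j \<and> w + \<Lambda> *\<^sub>R d \<in> pf_simplex \<and>
      (\<forall>l. w + l *\<^sub>R d \<in> pf_simplex \<longrightarrow> l \<le> \<Lambda>))"
proof -
  let ?L = "{l. w + l *\<^sub>R d \<in> pf_simplex}"
  define \<Lambda> where "\<Lambda> = max_step w d"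
  have ne: "1 \<in> ?L" using y by simp
  obtain M where M: "\<And>v. v \<in> pf_simplex \<Longrightarrow> norm (v :: real ^ 'n) \<le> M"
    using compact_imp_bounded[OF compact_pf_simplex] unfolding bounded_iff by blast
  have "l \<le> (M + norm w) / norm d" if "l \<in> ?L" for l
  proof -
    have "\<bar>l\<bar> * norm d = norm ((w + l *\<^sub>R d) - w)" by simp
    also have "\<dots> \<le> norm (w + l *\<^sub>R d) + norm w" by (rule norm_triangle_ineq4)
    also have "\<dots> \<le> M + norm w" using M that by simp
    finally have "\<bar>l\<bar> \<le> (M + norm w) / norm d" using d by (simp add: pos_le_divide_eq)
    then show ?thesis by linarith
  qed
  then have bdd: "bdd_above ?L" by (rule bdd_aboveI)
  have closed: "closed ?L"
    using continuous_closed_vimage[OF compact_imp_closed[OF compact_pf_simplex], of "\<lambda>l. w + l *\<^sub>R d"]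
    by (simp add: vimage_def)
  have \<Lambda>_in: "w + \<Lambda> *\<^sub>R d \<in> pf_simplex"
    using closed_contains_Sup[OF _ bdd closed] ne unfolding \<Lambda>_def max_step_def by blast
  have \<Lambda>_max: "l \<le> \<Lambda>" if "w + l *\<^sub>R d \<in> pf_simplex" for l
    unfolding \<Lambda>_def max_step_def using that bdd by (intro cSup_upper) auto
  have \<Lambda>: "1 \<le> \<Lambda>" using ne by (intro \<Lambda>_max) simp
  define trial where "trial = (\<lambda>j. ((\<lambda>l. max 1 (\<beta> * l)) ^^ j) \<Lambda>)"
  \<comment> \<open>Truncating at 1 in every round equals truncating once at the end, because
    \<open>\<beta> < 1\<close>.\<close>
  have max_idem: "max 1 (\<beta> * max 1 l) = max 1 (\<beta> * l)" for l
  proof (cases "1 \<le> l")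
    case False
    then have "\<beta> * l \<le> \<beta> * 1" using \<beta> by (intro mult_left_mono) auto
    then have "\<beta> * l \<le> 1" using \<beta> by linarith
    then show ?thesis using False \<beta> by (simp add: max_absorb1)
  qed (simp add: max_absorb2)
  have trial: "trial j = max 1 (\<Lambda> * \<beta> ^ j)" for j
  proof (induction j)
    case 0 then show ?case using \<Lambda> by (simp add: trial_def)
  next
    case (Suc j)
    have "trial (Suc j) = max 1 (\<beta> * trial j)" by (simp add: trial_def)
    also have "\<dots> = max 1 (\<Lambda> * \<beta> ^ Suc j)" unfolding Suc max_idem by (simp add: mult_ac)
    finally show ?case .
  qed
  let ?ok = "\<lambda>j. \<not> (\<phi> (w + trial j *\<^sub>R d) > \<phi> w - \<rho> * (trial j)\<^sup>2 * (norm d)\<^sup>2)"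
  \<comment> \<open>The trial step eventually equals 1, where the test succeeds by
    \<open>dec\<close>; hence the least successful index exists.\<close>
  have "(\<lambda>j. \<Lambda> * \<beta> ^ j) \<longlonglongrightarrow> \<Lambda> * 0" using \<beta> by (intro tendsto_intros LIMSEQ_realpow_zero) auto
  then have "\<forall>\<^sub>F j in sequentially. \<Lambda> * \<beta> ^ j < 1" by (intro order_tendstoD) auto
  then obtain j where "\<Lambda> * \<beta> ^ j < 1" by (auto simp: eventually_sequentially)
  then have "trial j = 1" unfolding trial by simp
  then have "?ok j" using dec by simp
  then have ok: "?ok (LEAST j. ?ok j)" by (rule LeastI)
  define J where "J = (LEAST j. ?ok j)"
  have \<theta>: "\<theta> = trial J"
    unfolding \<theta>_def bdca_stepsize_def Let_def J_def trial_def \<Lambda>_def ..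
  show "1 \<le> \<theta>" unfolding \<theta> trial by simp
  show "\<phi> (w + \<theta> *\<^sub>R d) \<le> \<phi> w - \<rho> * \<theta>\<^sup>2 * (norm d)\<^sup>2" using ok unfolding \<theta> J_def by simp
  have "\<Lambda> * \<beta> ^ J \<le> \<Lambda> * 1" using \<Lambda> \<beta> by (intro mult_left_mono power_le_one) auto
  then have le: "\<theta> \<le> \<Lambda>" using \<Lambda> unfolding \<theta> trial by simp
  have "(1 - \<theta> / \<Lambda>) *\<^sub>R w + (\<theta> / \<Lambda>) *\<^sub>R (w + \<Lambda> *\<^sub>R d) \<in> pf_simplex"
    using le \<Lambda> \<open>1 \<le> \<theta>\<close> w \<Lambda>_in by (intro convexD[OF convex_pf_simplex]) auto
  then show "w + \<theta> *\<^sub>R d \<in> pf_simplex" using \<Lambda> by (simp add: algebra_simps)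
  show "\<theta> = 1 \<or> (\<exists>\<Lambda> j. \<theta> = \<Lambda> * \<beta> ^ j \<and> w + \<Lambda> *\<^sub>R d \<in> pf_simplex \<and>
      (\<forall>l. w + l *\<^sub>R d \<in> pf_simplex \<longrightarrow> l \<le> \<Lambda>))"
    using \<Lambda>_in \<Lambda>_max unfolding \<theta> trial max_def by auto
qed

section \<open>First-order conditions and reduction to polyhedral data\<close>

lemma psi_add_minimiser_optimality:
  fixes v z u :: "real ^ 'n"
  assumes C: "convex C" and F: "convex_on C F" and v: "v \<in> C" and z: "z \<in> C"
    and min: "\<And>z. z \<in> C \<Longrightarrow> psi \<rho> v + F v - v \<bullet> u \<le> psi \<rho> z + F z - z \<bullet> u"
  shows "F v + (u - \<rho> *\<^sub>R v) \<bullet> (z - v) \<le> F z"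
proof -
  define a where "a = (u - \<rho> *\<^sub>R v) \<bullet> (z - v)"
  define b where "b = \<rho> / 2 * (norm (z - v))\<^sup>2"
  \<comment> \<open>Moving a fraction \<open>t\<close> towards \<open>z\<close> and dividing by
    \<open>t\<close> leaves the quadratic term with a factor \<open>t\<close>, which vanishes in the
    limit.\<close>
  have le: "a \<le> F z - F v + t * b" if t: "0 < t" "t < 1" for t
  proof -
    let ?z = "(1 - t) *\<^sub>R v + t *\<^sub>R z"
    have zt: "?z = v + t *\<^sub>R (z - v)" by (simp add: algebra_simps)
    have "?z \<in> C" using t v z by (intro convexD[OF C]) auto
    then have 1: "psi \<rho> v + F v - v \<bullet> u \<le> psi \<rho> ?z + F ?z - ?z \<bullet> u" by (rule min)
    have 2: "F ?z \<le> (1 - t) * F v + t * F z" using t v z by (intro convex_onD[OF F]) auto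
    have 3: "psi \<rho> ?z = psi \<rho> v + t * (\<rho> * (v \<bullet> (z - v))) + t * (t * b)"
    proof -
      have norm_z: "(norm ?z)\<^sup>2 = (norm v)\<^sup>2 + 2 * t * (v \<bullet> (z - v)) + t\<^sup>2 * (norm (z - v))\<^sup>2"
        unfolding zt power2_norm_eq_inner
        by (simp only: inner_add_left inner_add_right inner_scaleR_left inner_scaleR_right inner_commute[of "z - v" v])
          (simp add: power2_eq_square algebra_simps)
      show ?thesis unfolding psi_def b_def norm_z by (simp add: algebra_simps power2_eq_square)
    qed
    have 4: "?z \<bullet> u = v \<bullet> u + t * (u \<bullet> (z - v))"
      unfolding zt by (simp only: inner_add_left inner_scaleR_left inner_commute[of v u] inner_commute[of "z - v" u])
    have "a = u \<bullet> (z - v) - \<rho> * (v \<bullet> (z - v))" unfolding a_def by (simp add: inner_diff_left)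
    then have "t * a = t * (u \<bullet> (z - v)) - t * (\<rho> * (v \<bullet> (z - v)))" by (simp add: right_diff_distrib)
    moreover have "(1 - t) * F v + t * F z = F v + t * (F z - F v)" by (simp add: algebra_simps)
    ultimately have "t * a \<le> t * (F z - F v) + t * (t * b)" using 1 2 3 4 by linarith
    then have "t * a \<le> t * (F z - F v + t * b)" by (simp add: algebra_simps)
    then show ?thesis using t by simp
  qed
  have "((\<lambda>t. F z - F v + t * b) \<longlongrightarrow> F z - F v + 0 * b) (at_right 0)" by (intro tendsto_intros)
  moreover have "\<forall>\<^sub>F t in at_right (0::real). a \<le> F z - F v + t * b"
    using eventually_at_right_real[of 0 1] le by (auto elim!: eventually_mono)
  ultimately have "a \<le> F z - F v + 0 * b" by (intro tendsto_lowerbound) auto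
  then show ?thesis unfolding a_def by simp
qed

lemma psi_has_derivative: "(psi \<rho> has_derivative (\<lambda>t. (\<rho> *\<^sub>R z) \<bullet> t)) (at z)"
  unfolding psi_def power2_norm_eq_inner by (auto intro!: derivative_eq_intros simp: inner_commute)

theorem theorem3:
  fixes S :: nat and x :: "nat \<Rightarrow> real ^ 'n" and p :: "nat \<Rightarrow> real"
    and \<alpha> \<gamma> rmin \<tau> \<rho> \<beta> :: real
    and w u y :: "nat \<Rightarrow> real ^ 'n" and wbar :: "real ^ 'n"
  assumes p_range: "\<forall>j<S. 0 \<le> p j \<and> p j \<le> 1"
    and p_sum: "(\<Sum>j<S. p j) = 1"
    and \<alpha>: "0 < \<alpha>" "\<alpha> < 1"
    and \<gamma>: "0 < \<gamma>" "\<forall>v. \<gamma> < cvar_eps S x p \<alpha> v"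
    and \<tau>: "\<tau> > 0" and \<rho>: "\<rho> > 0" and \<beta>: "0 < \<beta>" "\<beta> < 1"
    and w0: "w 0 \<in> pf_simplex"
    and u: "\<forall>k. u k \<in> convex_subdiff (hfun S x p \<alpha> \<gamma> \<tau> \<rho>) (w k)"
    and y: "\<forall>k. y k \<in> pf_simplex \<and> (\<forall>v\<in>pf_simplex.
              gfun S x p \<alpha> \<gamma> rmin \<tau> \<rho> (y k) - y k \<bullet> u k
                \<le> gfun S x p \<alpha> \<gamma> rmin \<tau> \<rho> v - v \<bullet> u k)"
    and step: "\<forall>k. w (Suc k) = (if y k - w k = 0 then w k
              else w k + bdca_stepsize (phifun S x p \<alpha> \<gamma> rmin \<tau> \<rho>) \<rho> \<beta> (w k) (y k - w k)
                           *\<^sub>R (y k - w k))"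
    and wbar: "wbar \<in> pf_simplex"
    and limpt: "\<exists>r. strict_mono r \<and> (w \<circ> r) \<longlonglongrightarrow> wbar"
    and lip: "grad_locally_lipschitz_at (gfun S x p \<alpha> \<gamma> rmin \<tau> \<rho>) wbar
              \<or> grad_locally_lipschitz_at (hfun S x p \<alpha> \<gamma> \<tau> \<rho>) wbar"
  shows "\<exists>C q. 0 < q \<and> q < 1 \<and> (\<forall>k. norm (w k - wbar) \<le> C * q ^ k)"
proof -
  interpret scenario_probs S p by unfold_locales (use p_range p_sum in auto)
  have perm: "sort_perm S x v permutes {..<S}" for v using sorts_sort_perm unfolding sorts_def by blast
  have eps: "\<gamma> < \<alpha> - (\<Sum>j<tail_count S p \<alpha> (sort_perm S x v). p (sort_perm S x v j))" for v
    using \<gamma>(2) by (simp add: cvar_eps_def cvar_k_def tail_count_def Let_def)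
  have a: "0 < \<alpha> - \<gamma>" "\<alpha> - \<gamma> < 1" using cvar_difference(1)[OF \<alpha> \<gamma>(1) perm eps] \<alpha> \<gamma>(1) by auto

  define m where "m = (\<Sum>j<S. p j *\<^sub>R x j)"
  \<comment> \<open>\<open>P1\<close> and \<open>P2\<close> hold the pieces of the two entries of
    the penalty maximum; the shape of the pairs matches \<open>affine_max_scale_add\<close>.\<close>
  define P1 where "P1 = (\<lambda>q. (0 + (1/\<gamma>) *\<^sub>R fst q, rmin + 1/\<gamma> * snd q)) ` cvar_pieces x \<alpha>"
  define P2 where "P2 = (\<lambda>q. (0 + (1/\<gamma>) *\<^sub>R fst q, 0 + 1/\<gamma> * snd q)) ` cvar_pieces x (\<alpha> - \<gamma>)"
  define A where "A = (\<lambda>q. (- m + \<tau> *\<^sub>R fst q, 0 + \<tau> * snd q)) ` (P1 \<union> P2)"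
  define B where "B = (\<lambda>q. (0 + (\<tau>/\<gamma>) *\<^sub>R fst q, 0 + \<tau>/\<gamma> * snd q)) ` cvar_pieces x (\<alpha> - \<gamma>)"
  have finP: "finite P1" "P1 \<noteq> {}" "finite P2" "P2 \<noteq> {}"
    unfolding P1_def P2_def using finite_cvar_pieces by auto
  have A: "finite A" "A \<noteq> {}" unfolding A_def using finP by auto
  have B: "finite B" "B \<noteq> {}" unfolding B_def using finite_cvar_pieces by auto
  have A_eq: "affine_max A v = fobj S x p v + \<tau> * max (- (\<alpha> / \<gamma>) * cvar S x p \<alpha> v + rmin)
      (- ((\<alpha> - \<gamma>) / \<gamma>) * cvar S x p (\<alpha> - \<gamma>) v)" for v
  proof -
    have "affine_max P1 v = - (\<alpha> / \<gamma>) * cvar S x p \<alpha> v + rmin"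
      unfolding P1_def using \<gamma>(1)
      by (subst affine_max_scale_add[OF finite_cvar_pieces]) (simp_all add: affine_max_cvar_pieces \<alpha>)
    moreover have "affine_max P2 v = - ((\<alpha> - \<gamma>) / \<gamma>) * cvar S x p (\<alpha> - \<gamma>) v"
      unfolding P2_def using \<gamma>(1)
      by (subst affine_max_scale_add[OF finite_cvar_pieces]) (simp_all add: affine_max_cvar_pieces[OF a])
    moreover have "- m \<bullet> v = fobj S x p v"
      unfolding m_def fobj_def by (simp add: inner_sum_left inner_sum_right inner_commute)
    ultimately show ?thesis
      unfolding A_def using finP \<tau> by (subst affine_max_scale_add) (auto simp: affine_max_Un)
  qed
  have B_eq: "affine_max B v = \<tau>/\<gamma> * affine_max (cvar_pieces x (\<alpha> - \<gamma>)) v" for v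
    unfolding B_def using \<gamma>(1) \<tau> by (subst affine_max_scale_add[OF finite_cvar_pieces]) auto
  have B_cvar: "affine_max B v = - \<tau> * ((\<alpha> - \<gamma>) / \<gamma>) * cvar S x p (\<alpha> - \<gamma>) v" for v
    unfolding B_eq affine_max_cvar_pieces[OF a] by simp
  have g_eq: "gfun S x p \<alpha> \<gamma> rmin \<tau> \<rho> = (\<lambda>v. psi \<rho> v + affine_max A v)"
    by (rule ext) (simp add: gfun_def A_eq)
  have h_eq: "hfun S x p \<alpha> \<gamma> \<tau> \<rho> = (\<lambda>v. psi \<rho> v + affine_max B v)"
    by (rule ext) (simp add: hfun_def B_cvar)
  define \<phi> where "\<phi> = (\<lambda>v. affine_max A v - affine_max B v)"
  have \<phi>_phifun: "phifun S x p \<alpha> \<gamma> rmin \<tau> \<rho> = \<phi>"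
    by (rule ext) (simp add: phifun_def g_eq h_eq \<phi>_def)

  define e where "e = (\<lambda>k. u k - \<rho> *\<^sub>R w k)"
  have y_in: "y k \<in> pf_simplex" for k using y by blast
  have y_opt: "affine_max A (y k) + (e k - \<rho> *\<^sub>R (y k - w k)) \<bullet> (v - y k) \<le> affine_max A v"
    if "v \<in> pf_simplex" for k v
  proof -
    have "convex_on pf_simplex (affine_max A)"
      using convex_on_affine_max[OF A] convex_pf_simplex by (auto intro: convex_on_subset)
    then have "affine_max A (y k) + (u k - \<rho> *\<^sub>R y k) \<bullet> (v - y k) \<le> affine_max A v"
      using y that unfolding g_eq by (intro psi_add_minimiser_optimality[OF convex_pf_simplex]) auto
    moreover have "e k - \<rho> *\<^sub>R (y k - w k) = u k - \<rho> *\<^sub>R y k" unfolding e_def by (simp add: algebra_simps)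
    ultimately show ?thesis by simp
  qed
  have e_sub: "affine_max B (w k) + e k \<bullet> (v - w k) \<le> affine_max B v" for k v
    unfolding e_def
  proof (rule psi_add_minimiser_optimality[OF convex_UNIV convex_on_affine_max[OF B]])
    fix z
    have "psi \<rho> (w k) + affine_max B (w k) + u k \<bullet> (z - w k) \<le> psi \<rho> z + affine_max B z"
      using u unfolding convex_subdiff_def h_eq by blast
    then show "psi \<rho> (w k) + affine_max B (w k) - w k \<bullet> u k \<le> psi \<rho> z + affine_max B z - z \<bullet> u k"
      by (simp add: inner_diff_right inner_commute)
  qed auto
  \<comment> \<open>For a zero direction the value 1 satisfies the locale conditions and leaves the
    iterate unchanged.\<close>
  define \<theta> where "\<theta> = (\<lambda>k. if y k - w k = 0 then 1 else bdca_stepsize \<phi> \<rho> \<beta> (w k) (y k - w k))"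
  have step': "w (Suc k) = w k + \<theta> k *\<^sub>R (y k - w k)" for k
    using step unfolding \<theta>_def \<phi>_phifun by auto
  \<comment> \<open>Optimality of \<open>y k\<close> tested at \<open>w k\<close> and the
    subgradient inequality tested at \<open>y k\<close> are added; the terms with \<open>e k\<close>
    cancel.\<close>
  have dec: "\<phi> (y k) \<le> \<phi> (w k) - \<rho> * (norm (y k - w k))\<^sup>2" if "w k \<in> pf_simplex" for k
  proof -
    have "(e k - \<rho> *\<^sub>R (y k - w k)) \<bullet> (w k - y k) = - (e k \<bullet> (y k - w k)) + \<rho> * (norm (y k - w k))\<^sup>2"
      by (simp add: inner_diff_left inner_diff_right power2_norm_eq_inner algebra_simps)
    with y_opt[OF that, of k] e_sub[of k "y k"] show ?thesis unfolding \<phi>_def by linarith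
  qed
  have search: "1 \<le> \<theta> k \<and> w (Suc k) \<in> pf_simplex \<and>
      \<phi> (w (Suc k)) \<le> \<phi> (w k) - \<rho> * (norm (w (Suc k) - w k))\<^sup>2 \<and>
      (\<theta> k = 1 \<or> (\<exists>\<Lambda> j. \<theta> k = \<Lambda> * \<beta> ^ j \<and> w k + \<Lambda> *\<^sub>R (y k - w k) \<in> pf_simplex \<and>
        (\<forall>l. w k + l *\<^sub>R (y k - w k) \<in> pf_simplex \<longrightarrow> l \<le> \<Lambda>)))"
    if w_in: "w k \<in> pf_simplex" for k
  proof (cases "y k - w k = 0")
    case True
    then show ?thesis using w_in step'[of k] unfolding \<theta>_def by simp
  next
    case False
    have \<theta>: "\<theta> k = bdca_stepsize \<phi> \<rho> \<beta> (w k) (y k - w k)" using False unfolding \<theta>_def by simp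
    have y': "w k + (y k - w k) \<in> pf_simplex" "\<phi> (w k + (y k - w k)) \<le> \<phi> (w k) - \<rho> * (norm (y k - w k))\<^sup>2"
      using y_in dec[OF w_in] by simp_all
    note bd = bdca_stepsize[OF w_in y'(1) False \<beta> y'(2), folded \<theta>]
    have "(norm (w (Suc k) - w k))\<^sup>2 = (\<theta> k)\<^sup>2 * (norm (y k - w k))\<^sup>2"
      unfolding step' by (simp add: power_mult_distrib)
    then show ?thesis using bd unfolding step'[symmetric] by (simp add: mult.assoc)
  qed
  have w_in: "w k \<in> pf_simplex" for k
    by (induction k) (use w0 search in auto)
  interpret bd: polyhedral_bdca A B w y e \<theta> \<rho> \<beta> wbar \<phi>
    by unfold_locales (use \<phi>_def A B \<rho> \<beta> w_in y_in y_opt e_sub step' search wbar limpt in blast)+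

  show ?thesis
    using lip
  proof
    assume "grad_locally_lipschitz_at (gfun S x p \<alpha> \<gamma> rmin \<tau> \<rho>) wbar"
    then obtain E where "((\<lambda>v. psi \<rho> v + affine_max A v) has_derivative (\<lambda>t. E \<bullet> t)) (at wbar)"
      unfolding grad_locally_lipschitz_at_def g_eq by (metis centre_in_ball)
    from has_derivative_diff[OF this psi_has_derivative[of \<rho> wbar]]
    have "(affine_max A has_derivative (\<lambda>t. (E - \<rho> *\<^sub>R wbar) \<bullet> t)) (at wbar)"
      by (simp add: inner_diff_left)
    from differentiable_affine_max_locally_affine[OF A this] show ?thesis
      using bd.linear_rate_if_first_component_smooth by blast
  next
    assume "grad_locally_lipschitz_at (hfun S x p \<alpha> \<gamma> \<tau> \<rho>) wbar"
    then obtain E where "((\<lambda>v. psi \<rho> v + affine_max B v) has_derivative (\<lambda>t. E \<bullet> t)) (at wbar)"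
      unfolding grad_locally_lipschitz_at_def h_eq by (metis centre_in_ball)
    from has_derivative_diff[OF this psi_has_derivative[of \<rho> wbar]]
    have DB: "(affine_max B has_derivative (\<lambda>t. (E - \<rho> *\<^sub>R wbar) \<bullet> t)) (at wbar)"
      by (simp add: inner_diff_left)
    define c where "c = E - \<rho> *\<^sub>R wbar"
    have "((\<lambda>v. \<gamma>/\<tau> * affine_max B v) has_derivative (\<lambda>t. \<gamma>/\<tau> * (c \<bullet> t))) (at wbar)"
      using DB unfolding c_def by (rule has_derivative_mult_right)
    moreover have "(\<lambda>v. \<gamma>/\<tau> * affine_max B v) = affine_max (cvar_pieces x (\<alpha> - \<gamma>))"
      using \<gamma>(1) \<tau> by (simp add: B_eq fun_eq_iff)
    ultimately have DC: "(affine_max (cvar_pieces x (\<alpha> - \<gamma>)) has_derivative (\<lambda>t. ((\<gamma>/\<tau>) *\<^sub>R c) \<bullet> t)) (at wbar)"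
      by simp
    obtain \<delta>1 \<xi> where \<delta>1: "\<delta>1 > 0" "\<And>v. v \<in> ball wbar \<delta>1 \<Longrightarrow>
        \<alpha> * cvar S x p \<alpha> v - (\<alpha> - \<gamma>) * cvar S x p (\<alpha> - \<gamma>) v = \<gamma> * (v \<bullet> \<xi>)"
      using value_at_risk_locally_linear[OF \<alpha> \<gamma>(1) _ DC] \<gamma>(2) by blast
    obtain \<delta>2 where \<delta>2: "\<delta>2 > 0" "\<And>v. v \<in> ball wbar \<delta>2 \<Longrightarrow> affine_max B v = affine_max B wbar + c \<bullet> (v - wbar)"
      using differentiable_affine_max_locally_affine[OF B DB] unfolding c_def by blast
    obtain \<delta>3 where \<delta>3: "\<delta>3 > 0" "\<And>k. w k \<in> ball wbar \<delta>3 \<Longrightarrow> y k \<in> ball wbar \<delta>3 \<Longrightarrow>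
        norm (y k - w k) < \<delta>3 \<Longrightarrow> \<phi> (y k) \<le> \<phi> wbar"
      using bd.\<phi>_y_le_nearby by blast
    \<comment> \<open>The tail term of the lower level cancels, and what remains is a penalty on the
      local value-at-risk \<open>v \<bullet> \<xi>\<close>.\<close>
    have \<phi>_var: "\<phi> v = - (m \<bullet> v) + \<tau> * max (rmin - v \<bullet> \<xi>) 0" if "v \<in> ball wbar \<delta>1" for v
    proof -
      define T where "T = - ((\<alpha> - \<gamma>) / \<gamma>) * cvar S x p (\<alpha> - \<gamma>) v"
      have 1: "- (\<alpha> / \<gamma>) * cvar S x p \<alpha> v + rmin = (rmin - v \<bullet> \<xi>) + T"
        using \<delta>1(2)[OF that] \<gamma>(1) unfolding T_def by (simp add: field_simps)
      have 2: "affine_max B v = \<tau> * T" unfolding B_cvar T_def by simp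
      have 3: "m \<bullet> v = - fobj S x p v"
        unfolding m_def fobj_def by (simp add: inner_sum_left inner_sum_right inner_commute)
      have 4: "max (r + T) T = max r 0 + T" for r by (simp add: max_def)
      show ?thesis
        unfolding \<phi>_def A_eq T_def[symmetric] 1 2 3 4 by (simp add: distrib_left)
    qed
    obtain \<delta>4 g1 g2 where \<delta>4: "\<delta>4 > 0" "\<delta>4 \<le> \<delta>1" "\<And>v. v \<in> ball wbar \<delta>4 \<Longrightarrow>
        \<phi> v = \<phi> wbar + max (g1 \<bullet> (v - wbar)) (g2 \<bullet> (v - wbar))"
    proof -
      have var: "((\<lambda>v. rmin - v \<bullet> \<xi>) \<longlongrightarrow> rmin - wbar \<bullet> \<xi>) (nhds wbar)"
        by (intro tendsto_intros filterlim_ident)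
      have \<phi>0: "\<phi> wbar = - (m \<bullet> wbar) + \<tau> * max (rmin - wbar \<bullet> \<xi>) 0" using \<delta>1(1) by (intro \<phi>_var) simp
      \<comment> \<open>At the threshold both pieces meet at \<open>wbar\<close>; otherwise the sign
        persists nearby and a single affine piece is taken twice.\<close>
      consider "rmin - wbar \<bullet> \<xi> = 0" | "0 < rmin - wbar \<bullet> \<xi>" | "rmin - wbar \<bullet> \<xi> < 0" by linarith
      then show ?thesis
      proof cases
        case 1
        show ?thesis
        proof (rule that[OF \<delta>1(1) order_refl, of "- m - \<tau> *\<^sub>R \<xi>" "- m"])
          fix v assume v: "v \<in> ball wbar \<delta>1"
          have "rmin - v \<bullet> \<xi> = - (\<xi> \<bullet> (v - wbar))" using 1 by (simp add: inner_diff_right inner_commute)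
          then have "\<phi> v = - (m \<bullet> v) + \<tau> * max (- (\<xi> \<bullet> (v - wbar))) 0" using \<phi>_var[OF v] by simp
          moreover have "\<tau> * max (- (\<xi> \<bullet> (v - wbar))) 0 = max (- (\<tau> * (\<xi> \<bullet> (v - wbar)))) 0"
            using \<tau> by (simp add: max_mult_distrib_left)
          moreover have "(- m - \<tau> *\<^sub>R \<xi>) \<bullet> (v - wbar) = - (m \<bullet> (v - wbar)) - \<tau> * (\<xi> \<bullet> (v - wbar))"
            by (simp add: inner_diff_left)
          moreover have "\<phi> wbar = - (m \<bullet> wbar)" using \<phi>0 1 by simp
          moreover have "m \<bullet> (v - wbar) = m \<bullet> v - m \<bullet> wbar" by (rule inner_diff_right)
          ultimately show "\<phi> v = \<phi> wbar + max ((- m - \<tau> *\<^sub>R \<xi>) \<bullet> (v - wbar)) (- m \<bullet> (v - wbar))"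
            by (simp only: inner_minus_left)
        qed
      next
        case 2
        have "\<forall>\<^sub>F v in nhds wbar. 0 < rmin - v \<bullet> \<xi>"
          using var 2 by (rule order_tendstoD(1))
        then obtain s where s: "s > 0" "\<And>v. dist v wbar < s \<Longrightarrow> 0 < rmin - v \<bullet> \<xi>"
          unfolding eventually_nhds_metric by blast
        show ?thesis
        proof (rule that[of "min s \<delta>1" "- m - \<tau> *\<^sub>R \<xi>" "- m - \<tau> *\<^sub>R \<xi>"])
          fix v assume "v \<in> ball wbar (min s \<delta>1)"
          then show "\<phi> v = \<phi> wbar + max ((- m - \<tau> *\<^sub>R \<xi>) \<bullet> (v - wbar)) ((- m - \<tau> *\<^sub>R \<xi>) \<bullet> (v - wbar))"
            using \<phi>_var[of v] \<phi>0 2 s(2)[of v]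
            by (simp add: dist_commute max_def inner_diff_left inner_diff_right inner_commute algebra_simps)
        qed (use s(1) \<delta>1(1) in auto)
      next
        case 3
        have "\<forall>\<^sub>F v in nhds wbar. rmin - v \<bullet> \<xi> < 0"
          using var 3 by (rule order_tendstoD(2))
        then obtain s where s: "s > 0" "\<And>v. dist v wbar < s \<Longrightarrow> rmin - v \<bullet> \<xi> < 0"
          unfolding eventually_nhds_metric by blast
        show ?thesis
        proof (rule that[of "min s \<delta>1" "- m" "- m"])
          fix v assume "v \<in> ball wbar (min s \<delta>1)"
          then show "\<phi> v = \<phi> wbar + max (- m \<bullet> (v - wbar)) (- m \<bullet> (v - wbar))"
            using \<phi>_var[of v] \<phi>0 3 s(2)[of v]
            by (simp add: dist_commute max_def inner_diff_right algebra_simps)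
        qed (use s(1) \<delta>1(1) in auto)
      qed
    qed
    show ?thesis
    proof (cases "\<exists>K. \<phi> (w K) \<le> \<phi> wbar")
      case True
      then show ?thesis using bd.linear_rate_if_terminating by blast
    next
      case False
      define \<delta> where "\<delta> = min (min \<delta>2 \<delta>3) \<delta>4"
      have \<delta>: "0 < \<delta>" "\<delta> \<le> \<delta>2" "\<delta> \<le> \<delta>3" "\<delta> \<le> \<delta>4" using \<delta>2(1) \<delta>3(1) \<delta>4(1) unfolding \<delta>_def by auto
      interpret sm: polyhedral_bdca_smooth A B w y e \<theta> \<rho> \<beta> wbar \<phi> \<delta> c g1 g2
      proof unfold_locales
        show "0 < \<delta>" by (rule \<delta>(1))
        show "affine_max B v = affine_max B wbar + c \<bullet> (v - wbar)" if "v \<in> ball wbar \<delta>" for v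
          using that \<delta> by (intro \<delta>2(2)) auto
        show "\<phi> v = \<phi> wbar + max (g1 \<bullet> (v - wbar)) (g2 \<bullet> (v - wbar))" if "v \<in> ball wbar \<delta>" for v
          using that \<delta> by (intro \<delta>4(3)) auto
        show "\<phi> wbar < \<phi> (w k)" for k using False not_le by blast
        show "\<phi> (y k) \<le> \<phi> wbar" if "w k \<in> ball wbar \<delta>" "y k \<in> ball wbar \<delta>" "norm (y k - w k) < \<delta>" for k
          using that \<delta> by (intro \<delta>3(2)) auto
      qed
      show ?thesis by (rule sm.linear_rate)
    qed
  qed
qed

end
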